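(* Let $m\ge 2$ and $r\ge 1$ be integers and let $V$ be a finite-dimensional complex vector space with $\dim V\ge 2mr$. Then the isotypic component of $S_{((2m+2)^m,(2m)^{2mr-m})}V$ in $S^{2mr+1}(S^{2m}V)$ is contained in $I_{2mr+1}(\sigma_r(Ch_{2m}(V^* )))$. Moreover, every irreducible submodule of $S^{2mr+1}(S^{2m}V)$ isomorphic to $S_\lambda V$, where $\lambda$ is an even partition that is smaller than $((2m+2)^{2m-1},2)$ in the lexicographic order, is contained in $I_{2mr+1}(\sigma_r(Ch_{2m}(V^* )))$.
   Context: For a finite-dimensional complex vector space $U$, the Chow variety is $Ch_d(U)=\mathbb{P}\{z\in S^dU \mid z=w_1\cdots w_d \text{ for some } w_i\in U\}\subset \mathbb{P}S^dU$. For a projective variety $X\subset\mathbb{P}W^*$, the $r$-th secant variety $\sigma_r(X)\subset\mathbb{P}W^*$ is the Zariski closure of $\bigcup_{p_1,\dots,p_r\in X}\langle p_1,\dots,p_r\rangle$, where $\langle p_1,\dots,p_r\rangle$ is the projective linear span. $I_\delta(X)\subset S^\delta W$ denotes the space of homogeneous degree-$\delta$ polynomials on $W^*$ vanishing on $X$; with $W=S^dV$ and $X=\sigma_r(Ch_d(V^* ))$ it is a $GL(V)$-submodule of $S^\delta(S^dV)$. For a partition $\lambda$, $S_\lambda V$ is the irreducible polynomial $GL(V)$-module of highest weight $\lambda$. Exponents denote repeated parts: $((2m+2)^m,(2m)^{2mr-m})$ has $m$ parts equal to $2m+2$ followed by $2mr-m$ parts equal to $2m$, and $((2m+2)^{2m-1},2)$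 has $2m-1$ parts equal to $2m+2$ followed by one part equal to $2$. A partition is even if all its parts are even. Lexicographic order on partitions (padded with zeros): $\lambda>\mu$ if the first nonvanishing $\lambda_i-\mu_i$ is positive. *)

theory Defs
  imports Complex_Main "HOL-Library.Function_Algebras" "HOL-Library.More_List"
begin

text \<open>
  Complex vector spaces are given by an explicit scalar multiplication \<open>sc\<close> on an additive group and,
  where needed, a carrier subspace \<open>U\<close>. Functions are added pointwise.
\<close>

definition pw_scale :: "(complex \<Rightarrow> 'b \<Rightarrow> 'b) \<Rightarrow> complex \<Rightarrow> ('a \<Rightarrow> 'b) \<Rightarrow> 'a \<Rightarrow> 'b" where
  "pw_scale sc c f = (\<lambda>x. sc c (f x))"

abbreviation fscale :: "complex \<Rightarrow> ('a \<Rightarrow> complex) \<Rightarrow> 'a \<Rightarrow> complex" where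
  "fscale \<equiv> pw_scale (*)"

text \<open>
  The dual \<open>U\<^sup>*\<close> of a subspace \<open>U\<close>. Functions on \<open>U\<close> are extended by zero outside \<open>U\<close>, so that
  they are determined by their values on \<open>U\<close>.
\<close>

definition dual_space :: "(complex \<Rightarrow> 'u::ab_group_add \<Rightarrow> 'u) \<Rightarrow> 'u set \<Rightarrow> ('u \<Rightarrow> complex) set" where
  "dual_space sc U = {f. (\<forall>x\<in>U. \<forall>y\<in>U. f (x + y) = f x + f y) \<and>
                         (\<forall>c. \<forall>x\<in>U. f (sc c x) = c * f x) \<and>
                         (\<forall>x. x \<notin> U \<longrightarrow> f x = 0)}"

text \<open>
  The symmetric power \<open>S\<^sup>k(U\<^sup>*)\<close>, realised as the space of homogeneous polynomial functions of
  degree \<open>k\<close> on \<open>U\<close>: the span of all products of \<open>k\<close> linear forms. (For \<open>k > 0\<close> the case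
  distinction is redundant; for \<open>k = 0\<close> it gives the functions that are constant on \<open>U\<close>.)
\<close>

definition sym_dual :: "(complex \<Rightarrow> 'u::ab_group_add \<Rightarrow> 'u) \<Rightarrow> 'u set \<Rightarrow> nat \<Rightarrow> ('u \<Rightarrow> complex) set" where
  "sym_dual sc U k = module.span fscale
     {(\<lambda>x. if x \<in> U then (\<Prod>i<k. w i x) else 0) | w. \<forall>i<k. w i \<in> dual_space sc U}"

text \<open>
  Points of a projective space are one-dimensional subspaces. For a set \<open>Z\<close> of vectors, \<open>proj_points sc Z\<close>
  is the set of points spanned by the nonzero elements of \<open>Z\<close>.
\<close>

definition proj_points :: "(complex \<Rightarrow> 'u::ab_group_add \<Rightarrow> 'u) \<Rightarrow> 'u set \<Rightarrow> 'u set set" where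
  "proj_points sc Z = {module.span sc {z} | z. z \<in> Z \<and> z \<noteq> 0}"

definition vanishes_on :: "('u \<Rightarrow> complex) \<Rightarrow> 'u set set \<Rightarrow> bool" where
  "vanishes_on F X \<longleftrightarrow> (\<forall>l\<in>X. \<forall>z\<in>l. F z = 0)"

text \<open>
  In the next three definitions \<open>U\<close> is the ambient finite-dimensional space and \<open>X\<close> is a set of
  points of \<open>\<P>U\<close>; \<open>proj_ideal sc U \<delta> X\<close> is the degree-\<open>\<delta>\<close> part \<open>I\<^sub>\<delta>(X)\<close> of the ideal of \<open>X\<close>.
\<close>

definition proj_ideal ::
  "(complex \<Rightarrow> 'u::ab_group_add \<Rightarrow> 'u) \<Rightarrow> 'u set \<Rightarrow> nat \<Rightarrow> 'u set set \<Rightarrow> ('u \<Rightarrow> complex) set" where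
  "proj_ideal sc U \<delta> X = {F \<in> sym_dual sc U \<delta>. vanishes_on F X}"

definition zariski_closure ::
  "(complex \<Rightarrow> 'u::ab_group_add \<Rightarrow> 'u) \<Rightarrow> 'u set \<Rightarrow> 'u set set \<Rightarrow> 'u set set" where
  "zariski_closure sc U X =
     {l \<in> proj_points sc U. \<forall>k. \<forall>F\<in>sym_dual sc U k. vanishes_on F X \<longrightarrow> vanishes_on F {l}}"

definition secant_variety ::
  "(complex \<Rightarrow> 'u::ab_group_add \<Rightarrow> 'u) \<Rightarrow> 'u set \<Rightarrow> nat \<Rightarrow> 'u set set \<Rightarrow> 'u set set" where
  "secant_variety sc U r X = zariski_closure sc U
     (\<Union>p\<in>{p :: nat \<Rightarrow> 'u set. \<forall>i<r. p i \<in> X}. proj_points sc (module.span sc (\<Union>i<r. p i)))"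

text \<open>
  From here on \<open>V\<close> is the whole type \<open>'v\<close> with scalar multiplication \<open>scale\<close>. Then \<open>S\<^sup>d(V\<^sup>*)\<close> is
  \<open>form_space scale d\<close>, the homogeneous polynomial functions of degree \<open>d\<close> on \<open>V\<close>. Since
  \<open>S\<^sup>d V\<close> is naturally the dual of \<open>S\<^sup>d(V\<^sup>*)\<close>, the space \<open>S\<^sup>\<delta>(S\<^sup>d V)\<close> is the space of homogeneous polynomial
  functions of degree \<open>\<delta>\<close> on \<open>S\<^sup>d(V\<^sup>*)\<close>.
\<close>

definition form_space :: "(complex \<Rightarrow> 'v::ab_group_add \<Rightarrow> 'v) \<Rightarrow> nat \<Rightarrow> ('v \<Rightarrow> complex) set" where
  "form_space scale d = sym_dual scale UNIV d"

definition sym_sym ::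
  "(complex \<Rightarrow> 'v::ab_group_add \<Rightarrow> 'v) \<Rightarrow> nat \<Rightarrow> nat \<Rightarrow> (('v \<Rightarrow> complex) \<Rightarrow> complex) set" where
  "sym_sym scale \<delta> d = sym_dual fscale (form_space scale d) \<delta>"

text \<open>The Chow variety \<open>Ch\<^sub>d(V\<^sup>*)\<close>.\<close>

definition chow_dual :: "(complex \<Rightarrow> 'v::ab_group_add \<Rightarrow> 'v) \<Rightarrow> nat \<Rightarrow> ('v \<Rightarrow> complex) set set" where
  "chow_dual scale d = proj_points fscale
     {z \<in> form_space scale d.
        \<exists>w. (\<forall>i<d. w i \<in> dual_space scale UNIV) \<and> z = (\<lambda>v. \<Prod>i<d. w i v)}"

definition GL :: "(complex \<Rightarrow> 'v::ab_group_add \<Rightarrow> 'v) \<Rightarrow> ('v \<Rightarrow> 'v) set" where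
  "GL scale = {g. Vector_Spaces.linear scale scale g \<and> bij g}"

text \<open>
  The action of \<open>GL(V)\<close> on \<open>S\<^sup>\<delta>(S\<^sup>d V)\<close>. On \<open>S\<^sup>d(V\<^sup>*)\<close> the element \<open>g\<close> sends \<open>P\<close> to \<open>P \<circ> g\<^sup>-\<^sup>1\<close>, hence it
  sends a function \<open>F\<close> on \<open>S\<^sup>d(V\<^sup>*)\<close> to \<open>P \<mapsto> F (P \<circ> g)\<close>; for \<open>\<delta> = d = 1\<close> this is the standard
  representation on \<open>V = V\<^sup>*\<^sup>*\<close>.
\<close>

definition gl_action :: "('v \<Rightarrow> 'v) \<Rightarrow> (('v \<Rightarrow> complex) \<Rightarrow> complex) \<Rightarrow> ('v \<Rightarrow> complex) \<Rightarrow> complex" where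
  "gl_action g F = (\<lambda>P. F (P \<circ> g))"

text \<open>
  A \<open>GL(V)\<close>-module consists of a complex vector space (a subspace \<open>M\<close> of a type with scalar
  multiplication \<open>sc\<close>) and an action \<open>\<rho>\<close>.
\<close>

definition gl_module :: "(complex \<Rightarrow> 'v::ab_group_add \<Rightarrow> 'v) \<Rightarrow>
    (complex \<Rightarrow> 'w::ab_group_add \<Rightarrow> 'w) \<Rightarrow> (('v \<Rightarrow> 'v) \<Rightarrow> 'w \<Rightarrow> 'w) \<Rightarrow> 'w set \<Rightarrow> bool" where
  "gl_module scale sc \<rho> M \<longleftrightarrow>
     vector_space sc \<and> module.subspace sc M \<and>
     (\<forall>g\<in>GL scale. \<forall>x\<in>M. \<rho> g x \<in> M) \<and>
     (\<forall>g\<in>GL scale. \<forall>x\<in>M. \<forall>y\<in>M. \<rho> g (x + y) = \<rho> g x + \<rho> g y) \<and>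
     (\<forall>g\<in>GL scale. \<forall>c. \<forall>x\<in>M. \<rho> g (sc c x) = sc c (\<rho> g x)) \<and>
     (\<forall>x\<in>M. \<rho> id x = x) \<and>
     (\<forall>g\<in>GL scale. \<forall>h\<in>GL scale. \<forall>x\<in>M. \<rho> (g \<circ> h) x = \<rho> g (\<rho> h x))"

definition irreducible_gl_module :: "(complex \<Rightarrow> 'v::ab_group_add \<Rightarrow> 'v) \<Rightarrow>
    (complex \<Rightarrow> 'w::ab_group_add \<Rightarrow> 'w) \<Rightarrow> (('v \<Rightarrow> 'v) \<Rightarrow> 'w \<Rightarrow> 'w) \<Rightarrow> 'w set \<Rightarrow> bool" where
  "irreducible_gl_module scale sc \<rho> M \<longleftrightarrow>
     gl_module scale sc \<rho> M \<and> M \<noteq> {0} \<and>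
     (\<forall>N. N \<subseteq> M \<and> gl_module scale sc \<rho> N \<longrightarrow> N = {0} \<or> N = M)"

text \<open>
  A module is polynomial if its matrix coefficients \<open>g \<mapsto> \<phi> (\<rho> g x)\<close> are (restrictions to \<open>GL(V)\<close> of)
  polynomial functions on \<open>End(V)\<close>, that is, sums of homogeneous ones.
\<close>

definition polynomial_gl_module :: "(complex \<Rightarrow> 'v::ab_group_add \<Rightarrow> 'v) \<Rightarrow>
    (complex \<Rightarrow> 'w::ab_group_add \<Rightarrow> 'w) \<Rightarrow> (('v \<Rightarrow> 'v) \<Rightarrow> 'w \<Rightarrow> 'w) \<Rightarrow> 'w set \<Rightarrow> bool" where
  "polynomial_gl_module scale sc \<rho> M \<longleftrightarrow>
     gl_module scale sc \<rho> M \<and>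
     (\<forall>\<phi>\<in>dual_space sc M. \<forall>x\<in>M.
        \<exists>p \<in> module.span fscale (\<Union>k. sym_dual (pw_scale scale) {g. Vector_Spaces.linear scale scale g} k).
          \<forall>g\<in>GL scale. \<phi> (\<rho> g x) = p g)"

text \<open>
  Partitions are weakly decreasing lists of positive integers; \<open>nth_default 0 lam i\<close> is the part with
  (zero-based) index \<open>i\<close> of \<open>lam\<close> padded with zeros.
\<close>

definition is_partition :: "nat list \<Rightarrow> bool" where
  "is_partition lam \<longleftrightarrow> sorted_wrt (\<ge>) lam \<and> (\<forall>p\<in>set lam. p > 0)"

definition even_partition :: "nat list \<Rightarrow> bool" where
  "even_partition lam \<longleftrightarrow> is_partition lam \<and> (\<forall>p\<in>set lam. even p)"

definition partition_less :: "nat list \<Rightarrow> nat list \<Rightarrow> bool" where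
  "partition_less \<mu> lam \<longleftrightarrow>
     (\<exists>i. nth_default 0 \<mu> i < nth_default 0 lam i \<and> (\<forall>j<i. nth_default 0 \<mu> j = nth_default 0 lam j))"

text \<open>
  \<open>M\<close> has highest weight \<open>\<lambda>\<close>: for some ordered basis \<open>b 0, \<dots>, b (n - 1)\<close> of \<open>V\<close> there is a nonzero
  vector of \<open>M\<close> that is fixed by the unipotent upper triangular matrices and on which the diagonal
  matrix with entries \<open>t i\<close> acts as \<open>\<Prod>i. t i ^ \<lambda> i\<close>. As \<open>M\<close> is stable under \<open>GL(V)\<close>, which acts
  transitively on ordered bases, the choice of basis is immaterial.
\<close>

definition ordered_basis :: "(complex \<Rightarrow> 'v::ab_group_add \<Rightarrow> 'v) \<Rightarrow> nat \<Rightarrow> (nat \<Rightarrow> 'v) \<Rightarrow> bool" where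
  "ordered_basis scale n b \<longleftrightarrow>
     inj_on b {..<n} \<and> \<not> module.dependent scale (b ` {..<n}) \<and> module.span scale (b ` {..<n}) = UNIV"

definition has_highest_weight :: "(complex \<Rightarrow> 'v::ab_group_add \<Rightarrow> 'v) \<Rightarrow>
    (('v \<Rightarrow> 'v) \<Rightarrow> 'w::zero \<Rightarrow> 'w) \<Rightarrow> (complex \<Rightarrow> 'w \<Rightarrow> 'w) \<Rightarrow> 'w set \<Rightarrow> nat list \<Rightarrow> bool" where
  "has_highest_weight scale \<rho> sc M lam \<longleftrightarrow>
     (\<exists>n b. ordered_basis scale n b \<and> length lam \<le> n \<and>
       (\<exists>x\<in>M. x \<noteq> 0 \<and>
         (\<forall>g\<in>GL scale. (\<forall>j<n. g (b j) - b j \<in> module.span scale (b ` {..<j})) \<longrightarrow> \<rho> g x = x) \<and>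
         (\<forall>g\<in>GL scale. \<forall>t. (\<forall>i<n. g (b i) = scale (t i) (b i)) \<longrightarrow>
            \<rho> g x = sc (\<Prod>i<n. t i ^ nth_default 0 lam i) x)))"

text \<open>
  The module \<open>M\<close> is (isomorphic to) \<open>S\<^sub>\<lambda> V\<close>, the irreducible polynomial \<open>GL(V)\<close>-module of highest
  weight \<open>\<lambda>\<close>. No module satisfies this if \<open>\<lambda>\<close> has more than \<open>dim V\<close> parts, in accordance with
  \<open>S\<^sub>\<lambda> V = 0\<close> in that case.
\<close>

definition is_schur_module :: "(complex \<Rightarrow> 'v::ab_group_add \<Rightarrow> 'v) \<Rightarrow>
    (complex \<Rightarrow> 'w::ab_group_add \<Rightarrow> 'w) \<Rightarrow> (('v \<Rightarrow> 'v) \<Rightarrow> 'w \<Rightarrow> 'w) \<Rightarrow> nat list \<Rightarrow> 'w set \<Rightarrow> bool" where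
  "is_schur_module scale sc \<rho> lam M \<longleftrightarrow>
     is_partition lam \<and> irreducible_gl_module scale sc \<rho> M \<and> polynomial_gl_module scale sc \<rho> M \<and>
     has_highest_weight scale \<rho> sc M lam"

text \<open>The isotypic component of \<open>S\<^sub>\<lambda> V\<close> in a module \<open>A\<close>: the sum of all submodules isomorphic to it.\<close>

definition isotypic_component :: "(complex \<Rightarrow> 'v::ab_group_add \<Rightarrow> 'v) \<Rightarrow>
    (complex \<Rightarrow> 'w::ab_group_add \<Rightarrow> 'w) \<Rightarrow> (('v \<Rightarrow> 'v) \<Rightarrow> 'w \<Rightarrow> 'w) \<Rightarrow> nat list \<Rightarrow> 'w set \<Rightarrow> 'w set" where
  "isotypic_component scale sc \<rho> lam A =
     module.span sc (\<Union>{M. M \<subseteq> A \<and> is_schur_module scale sc \<rho> lam M})"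

text \<open>\<open>I\<^sub>\<delta>(\<sigma>\<^sub>r(Ch\<^sub>d(V\<^sup>*)))\<close>\<close>

definition chow_secant_ideal ::
  "(complex \<Rightarrow> 'v::ab_group_add \<Rightarrow> 'v) \<Rightarrow> nat \<Rightarrow> nat \<Rightarrow> nat \<Rightarrow> (('v \<Rightarrow> complex) \<Rightarrow> complex) set" where
  "chow_secant_ideal scale \<delta> r d =
     proj_ideal fscale (form_space scale d) \<delta>
       (secant_variety fscale (form_space scale d) r (chow_dual scale d))"

end

theory Submission
  imports Defs "HOL-Computational_Algebra.Polynomial"
begin

text \<open>
  Write \<open>q = 2 m\<close>. By irreducibility it suffices that a highest weight vector \<open>F\<close> of weight \<open>\<lambda>\<close> vanishes
  at all sums of \<open>r\<close> products of \<open>q\<close> linear forms. As \<open>F\<close> has degree \<open>q r + 1\<close>, this holds as soon as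
  \<open>F (R + \<gamma> w\<^sub>1 \<cdots> w\<^sub>q)\<close> has degree at most \<open>q\<close> in \<open>\<gamma>\<close>. So let \<open>f (w\<^sub>1, \<dots>, w\<^sub>q)\<close> be the coefficient of \<open>\<gamma>\<^sup>a\<close>,
  \<open>a > q\<close>; it is symmetric and homogeneous of degree \<open>a\<close> in every \<open>w\<^sub>i\<close>.

  Acting with the elements of \<open>GL(V)\<close> that multiply \<open>p\<close> given generic forms \<open>u\<^sub>1, \<dots>, u\<^sub>p\<close> by \<open>c\<close> shows that the total
  degree in \<open>u\<^sub>1, \<dots>, u\<^sub>p\<close> of \<open>F\<close> along any family is at most \<open>\<lambda>\<^sub>1 + \<cdots> + \<lambda>\<^sub>p\<close>. The hypotheses on \<open>\<lambda>\<close> give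
  \<open>\<lambda>\<^sub>1 \<le> q + 2\<close> and \<open>\<lambda>\<^sub>1 + \<cdots> + \<lambda>\<^sub>q\<^sub>-\<^sub>1 < (q - 1) (q + 2)\<close>. The second bound excludes \<open>a \<ge> q + 2\<close>. For
  \<open>a = q + 1\<close>, let \<open>E\<^sub>i\<^sub>j\<close> be the derivation that replaces \<open>w\<^sub>j\<close> by \<open>w\<^sub>i\<close>. Symmetry, the oddness of \<open>a\<close> and the first
  bound yield \<open>E\<^sub>q\<^sub>i E\<^sub>i\<^sub>q f = 2 f\<close> and \<open>E\<^sub>k\<^sub>i E\<^sub>i\<^sub>q f = - E\<^sub>k\<^sub>q f\<close>, whence
  \<open>E\<^sub>q\<^sub>i (\<Prod>\<^sub>k E\<^sub>k\<^sub>q) E\<^sub>i\<^sub>q f = (s + 2) (\<Prod>\<^sub>k E\<^sub>k\<^sub>q) f\<close> for products of \<open>s\<close> factors. The product over all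
  \<open>k < q\<close> kills \<open>f\<close> by the second bound, and removing the factors one at a time gives \<open>f = 0\<close>.
\<close>

section \<open>Polynomial functions\<close>

type_synonym cmat = "nat \<Rightarrow> nat \<Rightarrow> complex"

section \<open>Degrees of polynomial functions of one variable\<close>

definition degree_at_most :: "(complex \<Rightarrow> complex) \<Rightarrow> nat \<Rightarrow> bool" where
  "degree_at_most g n \<longleftrightarrow> (\<exists>P. degree P \<le> n \<and> (\<forall>t. g t = poly P t))"

lemma degree_at_mostI: "degree P \<le> n \<Longrightarrow> (\<And>t. g t = poly P t) \<Longrightarrow> degree_at_most g n"
  unfolding degree_at_most_def by blast

lemma degree_at_mostE:
  assumes "degree_at_most g n"
  obtains P where "degree P \<le> n" "\<And>t. g t = poly P t"
  using assms unfolding degree_at_most_def by blast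

lemma poly_eq_sum:
  fixes P :: "complex poly"
  assumes "degree P \<le> n"
  shows "poly P t = (\<Sum>i\<le>n. coeff P i * t ^ i)"
  unfolding poly_altdef using assms
  by (intro sum.mono_neutral_left) (auto simp: coeff_eq_0)

lemma degree_at_most_mono: "degree_at_most g m \<Longrightarrow> m \<le> n \<Longrightarrow> degree_at_most g n"
  unfolding degree_at_most_def using order_trans by blast

lemma degree_at_most_diff:
  assumes "degree_at_most g n" "degree_at_most h n"
  shows "degree_at_most (\<lambda>t. g t - h t) n"
proof -
  obtain P Q where "degree P \<le> n" "\<And>t. g t = poly P t" "degree Q \<le> n" "\<And>t. h t = poly Q t"
    using assms by (metis degree_at_mostE)
  then show ?thesis
    by (intro degree_at_mostI[of "P - Q"]) (auto intro: degree_diff_le)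
qed

lemma poly_eq_if_eq_nonzero:
  fixes P Q :: "complex poly"
  assumes "\<And>t. t \<noteq> 0 \<Longrightarrow> poly P t = poly Q t"
  shows "P = Q"
proof (rule ccontr)
  assume "P \<noteq> Q"
  then have "finite {t. poly (P - Q) t = 0}"
    by (intro poly_roots_finite) simp
  moreover have "UNIV - {0} \<subseteq> {t. poly (P - Q) t = 0}"
    using assms by auto
  ultimately have "finite (UNIV - {0 :: complex})"
    by (rule rev_finite_subset)
  then show False
    using infinite_UNIV_char_0 by (metis finite_Diff2 finite.emptyI finite_insert)
qed

lemma degree_at_most_cancel:
  fixes P :: "complex poly"
  assumes "degree_at_most g (a + n)" and "\<And>t. t \<noteq> 0 \<Longrightarrow> g t = t ^ a * poly P t"
  shows "degree P \<le> n"
proof (cases "P = 0")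
  case False
  obtain Q where Q: "degree Q \<le> a + n" "\<And>t. g t = poly Q t"
    using assms(1) by (rule degree_at_mostE) blast
  have "monom 1 a * P = Q"
    using Q(2) assms(2) by (intro poly_eq_if_eq_nonzero) (simp add: poly_monom)
  moreover have "degree (monom 1 a * P) = a + degree P"
    using False by (simp add: degree_mult_eq degree_monom_eq monom_eq_0_iff)
  ultimately show ?thesis using Q(1) by simp
qed simp

lemma degree_at_most_monom_eq_0:
  assumes "degree_at_most g m" "\<And>c. g c = c ^ n * a" "m < n"
  shows "a = 0"
proof -
  obtain P where P: "degree P \<le> m" "\<And>c. g c = poly P c"
    using assms(1) by (rule degree_at_mostE) blast
  have "P = monom a n"
    by (intro poly_eq_if_eq_nonzero) (simp add: poly_monom P(2)[symmetric] assms(2) mult.commute)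
  then show ?thesis
    using P(1) assms(3) degree_monom_eq[of a n] by fastforce
qed

text \<open>Multiplying by \<open>c ^ degree Q\<close> turns \<open>poly Q (1 / c)\<close> into the
  reflected polynomial, of degree at most \<open>degree Q\<close>. This is how a torus weight
  \<open>n\<close> becomes a degree bound.\<close>

lemma degree_at_most_reciprocal:
  fixes P Q :: "complex poly"
  assumes "\<And>c. c \<noteq> 0 \<Longrightarrow> poly P c = c ^ n * poly Q (1 / c)"
  shows "degree P \<le> n"
proof (cases "P = 0")
  case False
  have "monom 1 (degree Q) * P = monom 1 n * reflect_poly Q"
  proof (rule poly_eq_if_eq_nonzero)
    fix c :: complex assume "c \<noteq> 0"
    then show "poly (monom 1 (degree Q) * P) c = poly (monom 1 n * reflect_poly Q) c"
      using assms[of c] by (simp add: poly_monom poly_reflect_poly_nz inverse_eq_divide)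
  qed
  then have "degree Q + degree P = degree (monom 1 n * reflect_poly Q)"
    using False by (metis degree_monom_eq degree_mult_eq monom_eq_0_iff one_neq_zero)
  also have "\<dots> \<le> n + degree Q"
    by (intro order_trans[OF degree_mult_le] add_mono degree_monom_le degree_reflect_poly_le)
  finally show ?thesis by simp
qed simp

section \<open>Polynomials in two variables, with \<open>t\<close> as outer and \<open>s\<close> as
  inner variable\<close>

lemma poly_poly_const: "poly (poly P [:t:]) s = poly (map_poly (\<lambda>a. poly a s) P) t" for s :: complex
  by (induction P) (simp_all add: map_poly_pCons)

lemma coeff_poly_const: "coeff (poly P [:t:]) j = poly (map_poly (\<lambda>a. coeff a j) P) t" for t :: complex
  by (induction P) (simp_all add: map_poly_pCons)

lemma degree_le_if_degree_at_most:
  fixes P :: "complex poly"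
  assumes "degree_at_most (poly P) n"
  shows "degree P \<le> n"
proof -
  obtain Q where "degree Q \<le> n" "\<And>t. poly P t = poly Q t"
    using assms by (rule degree_at_mostE) blast
  then have "P = Q" by (intro poly_eq_if_eq_nonzero) simp
  with \<open>degree Q \<le> n\<close> show ?thesis by simp
qed

text \<open>For \<open>j > n\<close> the coefficient of \<open>t ^ j\<close> is a polynomial in
  \<open>s\<close> with infinitely many zeros, hence zero. A bound known for generic
  \<open>s\<close> can thus be specialised.\<close>

lemma degree_at_most_dense:
  assumes "infinite S" and "\<And>s. s \<in> S \<Longrightarrow> degree_at_most (\<lambda>t. poly (poly P [:t:]) s) n"
  shows "degree_at_most (\<lambda>t. poly (poly P [:t:]) s) n"
proof (rule degree_at_mostI[of "map_poly (\<lambda>a. poly a s) P"])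
  have "coeff P j = 0" if "j > n" for j
  proof (rule ccontr)
    assume "coeff P j \<noteq> 0"
    then have "finite {s. poly (coeff P j) s = 0}"
      by (rule poly_roots_finite)
    moreover have "S \<subseteq> {s. poly (coeff P j) s = 0}"
    proof
      fix s assume "s \<in> S"
      then have "degree_at_most (\<lambda>t. poly (map_poly (\<lambda>a. poly a s) P) t) n"
        using assms(2) by (simp only: poly_poly_const)
      then have "degree (map_poly (\<lambda>a. poly a s) P) \<le> n"
        by (intro degree_le_if_degree_at_most) simp
      then have "coeff (map_poly (\<lambda>a. poly a s) P) j = 0"
        using that by (intro coeff_eq_0) simp
      then show "s \<in> {s. poly (coeff P j) s = 0}"
        by (simp add: coeff_map_poly)
    qed
    ultimately show False
      using assms(1) finite_subset by blast
  qed
  then show "degree (map_poly (\<lambda>a. poly a s) P) \<le> n"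
    by (intro degree_le) (simp add: coeff_map_poly)
qed (rule poly_poly_const)

text \<open>For \<open>i > n\<close> the coefficient of \<open>s ^ i\<close> is a polynomial in
  \<open>t\<close> that vanishes everywhere.\<close>

lemma degree_coeff_le:
  assumes "\<And>t. degree_at_most (poly (poly P [:t:])) n"
  shows "degree (coeff P j :: complex poly) \<le> n"
proof (rule degree_le, intro allI impI)
  fix i assume "i > n"
  have "map_poly (\<lambda>a. coeff a i) P = 0"
  proof (rule poly_eq_if_eq_nonzero)
    fix t
    have "degree (poly P [:t:]) \<le> n"
      using assms by (rule degree_le_if_degree_at_most)
    then have "coeff (poly P [:t:]) i = 0"
      using \<open>i > n\<close> by (intro coeff_eq_0) simp
    then show "poly (map_poly (\<lambda>a. coeff a i) P) t = poly 0 t"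
      by (simp add: coeff_poly_const)
  qed
  then have "coeff (map_poly (\<lambda>a. coeff a i) P) j = 0"
    by simp
  then show "coeff (coeff P j) i = 0"
    by (simp add: coeff_map_poly)
qed

text \<open>Only powers of \<open>t\<close> up to \<open>n\<close> occur, with coefficients of
  degree at most \<open>m\<close> in \<open>s\<close>; putting \<open>t = s\<close> adds the
  bounds.\<close>

lemma degree_at_most_diagonal:
  fixes P :: "complex poly poly"
  assumes "\<And>t. degree_at_most (poly (poly P [:t:])) m"
    and "\<And>s. degree_at_most (\<lambda>t. poly (poly P [:t:]) s) n"
  shows "degree_at_most (\<lambda>s. poly (poly P [:s:]) s) (m + n)"
proof (rule degree_at_mostI)
  show "degree (\<Sum>j\<le>n. coeff P j * monom 1 j) \<le> m + n"
  proof (rule degree_sum_le)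
    fix j assume "j \<in> {..n}"
    then show "degree (coeff P j * monom 1 j) \<le> m + n"
      by (intro order_trans[OF degree_mult_le] add_mono degree_coeff_le assms(1))
        (simp add: degree_monom_eq)
  qed simp
  fix s
  have "degree (map_poly (\<lambda>a. poly a s) P) \<le> n"
    using assms(2)[of s] unfolding poly_poly_const by (rule degree_le_if_degree_at_most)
  then show "poly (poly P [:s:]) s = poly (\<Sum>j\<le>n. coeff P j * monom 1 j) s"
    unfolding poly_poly_const poly_sum
    by (subst poly_eq_sum) (auto simp: coeff_map_poly poly_monom)
qed

lemma infinite_cmod_gt: "infinite {z :: complex. cmod z > C}"
proof
  assume fin: "finite {z :: complex. cmod z > C}"
  have "of_nat ` {nat \<lceil>C\<rceil><..} \<subseteq> {z :: complex. cmod z > C}"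
    by (auto simp: norm_of_nat) linarith
  then have "finite ((of_nat :: nat \<Rightarrow> complex) ` {nat \<lceil>C\<rceil><..})"
    using fin finite_subset by blast
  then have "finite {nat \<lceil>C\<rceil><..}"
    by (rule finite_imageD) (auto simp: inj_on_def)
  then show False by (simp add: infinite_Ioi)
qed

section \<open>Polynomial functions of the entries of a matrix\<close>

inductive mpoly :: "(cmat \<Rightarrow> complex) \<Rightarrow> bool" where
  mpoly_const: "mpoly (\<lambda>_. c)"
| mpoly_var: "mpoly (\<lambda>x. x j l)"
| mpoly_add: "mpoly g \<Longrightarrow> mpoly h \<Longrightarrow> mpoly (\<lambda>x. g x + h x)"
| mpoly_mult: "mpoly g \<Longrightarrow> mpoly h \<Longrightarrow> mpoly (\<lambda>x. g x * h x)"

lemma mpoly_line: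
  assumes "mpoly h"
  shows "\<exists>P. \<forall>t. h (\<lambda>j l. y j l + t * z j l) = poly P t"
  using assms
proof induction
  case (mpoly_const c)
  show ?case by (rule exI[of _ "[:c:]"]) simp
next
  case (mpoly_var j l)
  show ?case by (rule exI[of _ "[:y j l, z j l:]"]) simp
next
  case (mpoly_add g h)
  then obtain P Q where "\<forall>t. g (\<lambda>j l. y j l + t * z j l) = poly P t"
    "\<forall>t. h (\<lambda>j l. y j l + t * z j l) = poly Q t"
    by blast
  then show ?case by (intro exI[of _ "P + Q"]) simp
next
  case (mpoly_mult g h)
  then obtain P Q where "\<forall>t. g (\<lambda>j l. y j l + t * z j l) = poly P t"
    "\<forall>t. h (\<lambda>j l. y j l + t * z j l) = poly Q t"
    by blast
  then show ?case by (intro exI[of _ "P * Q"]) simp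
qed

lemma mpoly_plane:
  assumes "mpoly h"
  shows "\<exists>P. \<forall>s t. h (\<lambda>j l. y j l + s * z j l + t * w j l) = poly (poly P [:t:]) s"
  using assms
proof induction
  case (mpoly_const c)
  show ?case by (rule exI[of _ "[:[:c:]:]"]) simp
next
  case (mpoly_var j l)
  show ?case by (rule exI[of _ "[:[:y j l, z j l:], [:w j l:]:]"]) simp
next
  case (mpoly_add g h)
  then obtain P Q where "\<forall>s t. g (\<lambda>j l. y j l + s * z j l + t * w j l) = poly (poly P [:t:]) s"
    "\<forall>s t. h (\<lambda>j l. y j l + s * z j l + t * w j l) = poly (poly Q [:t:]) s"
    by blast
  then show ?case by (intro exI[of _ "P + Q"]) simp
next
  case (mpoly_mult g h)
  then obtain P Q where "\<forall>s t. g (\<lambda>j l. y j l + s * z j l + t * w j l) = poly (poly P [:t:]) s"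
    "\<forall>s t. h (\<lambda>j l. y j l + s * z j l + t * w j l) = poly (poly Q [:t:]) s"
    by blast
  then show ?case by (intro exI[of _ "P * Q"]) simp
qed

text \<open>One entry becomes the variable of a polynomial whose coefficients still depend
  polynomially on the matrix. It later serves to extract the coefficients of the powers of
  \<gamma>.\<close>

lemma mpoly_coeff:
  assumes "mpoly h"
  shows "\<exists>p. (\<forall>x c. h (x(i := (x i)(l := c))) = poly (p x) c) \<and> (\<forall>k. mpoly (\<lambda>x. coeff (p x) k))"
  using assms
proof induction
  case (mpoly_const c)
  show ?case
    by (rule exI[of _ "\<lambda>_. [:c:]"]) (auto simp: mpoly.mpoly_const)
next
  case (mpoly_var j l')
  show ?case
  proof (cases "j = i \<and> l' = l")
    case True
    then show ?thesis
      by (intro exI[of _ "\<lambda>_. [:0, 1:]"]) (auto simp: mpoly.mpoly_const)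
  next
    case False
    have "mpoly (\<lambda>x. coeff [:x j l':] k)" for k
      by (cases k) (auto simp: mpoly.mpoly_const mpoly.mpoly_var)
    then show ?thesis
      using False by (intro exI[of _ "\<lambda>x. [:x j l':]"]) auto
  qed
next
  case (mpoly_add g h)
  then obtain p q where pq: "\<forall>x c. g (x(i := (x i)(l := c))) = poly (p x) c" "\<forall>k. mpoly (\<lambda>x. coeff (p x) k)"
    "\<forall>x c. h (x(i := (x i)(l := c))) = poly (q x) c" "\<forall>k. mpoly (\<lambda>x. coeff (q x) k)"
    by blast
  then show ?case
    by (intro exI[of _ "\<lambda>x. p x + q x"])
      (simp only: coeff_add poly_add mpoly.mpoly_add pq simp_thms)
next
  case (mpoly_mult g h)
  then obtain p q where pq: "\<forall>x c. g (x(i := (x i)(l := c))) = poly (p x) c" "\<forall>k. mpoly (\<lambda>x. coeff (p x) k)"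
    "\<forall>x c. h (x(i := (x i)(l := c))) = poly (q x) c" "\<forall>k. mpoly (\<lambda>x. coeff (q x) k)"
    by blast
  have "mpoly (\<lambda>x. \<Sum>i\<le>n. coeff (p x) i * coeff (q x) (k - i))" for k n
    using pq by (induction n) (simp_all add: mpoly.mpoly_add mpoly.mpoly_mult)
  then show ?case
    by (intro exI[of _ "\<lambda>x. p x * q x"]) (simp only: coeff_mult poly_mult pq simp_thms)
qed

section \<open>Symmetric functions of the rows of a matrix\<close>

definition addrow :: "nat \<Rightarrow> nat \<Rightarrow> complex \<Rightarrow> cmat \<Rightarrow> cmat" where
  "addrow i j t x = (\<lambda>a l. if a = j then x j l + t * x i l else x a l)"

definition scalerow :: "nat \<Rightarrow> complex \<Rightarrow> cmat \<Rightarrow> cmat" where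
  "scalerow i c x = (\<lambda>a l. if a = i then c * x i l else x a l)"

definition swaprow :: "nat \<Rightarrow> nat \<Rightarrow> cmat \<Rightarrow> cmat" where
  "swaprow i j x = (\<lambda>a. if a = i then x j else if a = j then x i else x a)"

lemma mpoly_addrow:
  assumes "mpoly h"
  shows "\<exists>P. \<forall>t. h (addrow i j t x) = poly P t"
proof -
  have "addrow i j t x = (\<lambda>a l. x a l + t * (if a = j then x i l else 0))" for t
    unfolding addrow_def by (intro ext) simp
  then show ?thesis
    by (simp only: mpoly_line[OF assms])
qed

text \<open>The infinitesimal row operation \<open>\<Sum>\<^sub>l x\<^sub>i\<^sub>l \<partial>/\<partial>x\<^sub>j\<^sub>l\<close>.\<close>

definition rowder :: "nat \<Rightarrow> nat \<Rightarrow> (cmat \<Rightarrow> complex) \<Rightarrow> cmat \<Rightarrow> complex" where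
  "rowder i j h x = coeff (THE P. \<forall>t. h (addrow i j t x) = poly P t) 1"

lemma rowder_eqI:
  assumes "\<And>t. h (addrow i j t x) = poly P t"
  shows "rowder i j h x = coeff P 1"
proof -
  have "(THE P. \<forall>t. h (addrow i j t x) = poly P t) = P"
    using assms by (intro the_equality) (auto intro: poly_eq_if_eq_nonzero)
  then show ?thesis by (simp add: rowder_def)
qed

lemma rowder_const: "rowder i j (\<lambda>_. c) = (\<lambda>_. 0)"
  by (rule ext, subst rowder_eqI[where P = "[:c:]"]) auto

lemma rowder_var: "rowder i j (\<lambda>x. x a l) = (if a = j then (\<lambda>x. x i l) else (\<lambda>_. 0))"
proof
  fix x :: cmat
  show "rowder i j (\<lambda>x. x a l) x = (if a = j then (\<lambda>x. x i l) else (\<lambda>_. 0)) x"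
    by (subst rowder_eqI[where P = "[:x a l, if a = j then x i l else 0:]"]) (auto simp: addrow_def)
qed

lemma rowder_add:
  assumes "mpoly g" "mpoly h"
  shows "rowder i j (\<lambda>x. g x + h x) = (\<lambda>x. rowder i j g x + rowder i j h x)"
proof
  fix x
  obtain P where P: "\<forall>t. g (addrow i j t x) = poly P t"
    using mpoly_addrow[OF assms(1)] by blast
  obtain Q where Q: "\<forall>t. h (addrow i j t x) = poly Q t"
    using mpoly_addrow[OF assms(2)] by blast
  have "rowder i j (\<lambda>x. g x + h x) x = coeff (P + Q) 1"
    by (rule rowder_eqI) (simp add: P Q)
  then show "rowder i j (\<lambda>x. g x + h x) x = rowder i j g x + rowder i j h x"
    by (simp add: rowder_eqI[OF P[rule_format]] rowder_eqI[OF Q[rule_format]])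
qed

lemma rowder_mult:
  assumes "mpoly g" "mpoly h"
  shows "rowder i j (\<lambda>x. g x * h x) = (\<lambda>x. rowder i j g x * h x + g x * rowder i j h x)"
proof
  fix x
  obtain P where P: "\<forall>t. g (addrow i j t x) = poly P t"
    using mpoly_addrow[OF assms(1)] by blast
  obtain Q where Q: "\<forall>t. h (addrow i j t x) = poly Q t"
    using mpoly_addrow[OF assms(2)] by blast
  have x: "addrow i j 0 x = x"
    by (auto simp: addrow_def fun_eq_iff)
  have "rowder i j (\<lambda>x. g x * h x) x = coeff (P * Q) 1"
    by (rule rowder_eqI) (simp add: P Q)
  moreover have "g x = coeff P 0" "h x = coeff Q 0"
    using P[rule_format, of 0] Q[rule_format, of 0] by (simp_all add: x poly_0_coeff_0)
  ultimately show "rowder i j (\<lambda>x. g x * h x) x = rowder i j g x * h x + g x * rowder i j h x"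
    unfolding rowder_eqI[OF P[rule_format]] rowder_eqI[OF Q[rule_format]] by (simp add: coeff_mult)
qed

lemma mpoly_rowder: "mpoly h \<Longrightarrow> mpoly (rowder i j h)"
proof (induction rule: mpoly.induct)
  case (mpoly_const c)
  show ?case unfolding rowder_const by (rule mpoly.intros)
next
  case (mpoly_var j l)
  show ?case unfolding rowder_var by (auto intro: mpoly.intros)
next
  case (mpoly_add g h)
  then show ?case by (simp add: rowder_add mpoly.mpoly_add)
next
  case (mpoly_mult g h)
  then show ?case
    unfolding rowder_mult[OF mpoly_mult.hyps] by (intro mpoly.mpoly_add mpoly.mpoly_mult)
qed

lemma rowder_cmult: "mpoly h \<Longrightarrow> rowder i j (\<lambda>x. c * h x) = (\<lambda>x. c * rowder i j h x)"
  by (simp add: rowder_mult mpoly_const rowder_const)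

text \<open>Neither operator differentiates the row that the other one inserts. As both are
  derivations, induction leaves only the entries to check.\<close>

lemma rowder_commute:
  assumes "mpoly h" "l \<noteq> i" "k \<noteq> p"
  shows "rowder k i (rowder l p h) = rowder l p (rowder k i h)"
  using assms(1)
proof induction
  case (mpoly_const c)
  show ?case by (simp add: rowder_const)
next
  case (mpoly_var a c)
  show ?case using assms by (auto simp: rowder_var rowder_const)
next
  case (mpoly_add g h)
  then show ?case by (simp add: rowder_add mpoly_rowder)
next
  case (mpoly_mult g h)
  then show ?case
    by (simp add: rowder_mult rowder_add mpoly_rowder mpoly.mpoly_mult algebra_simps)
qed

text \<open>The relation \<open>[E\<^sub>p\<^sub>i, E\<^sub>k\<^sub>p] = - E\<^sub>k\<^sub>i\<close>
  of the general linear Lie algebra. A commutator of derivations is a derivation, so comparison on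
  entries suffices.\<close>

lemma rowder_commutator:
  assumes "mpoly h" "k \<noteq> i"
  shows "rowder p i (rowder k p h) = (\<lambda>x. rowder k p (rowder p i h) x - rowder k i h x)"
  using assms(1)
proof induction
  case (mpoly_const c)
  show ?case by (simp add: rowder_const)
next
  case (mpoly_var a c)
  show ?case using assms by (auto simp: rowder_var rowder_const)
next
  case (mpoly_add g h)
  then show ?case by (simp add: rowder_add mpoly_rowder algebra_simps)
next
  case (mpoly_mult g h)
  then show ?case
    by (simp add: rowder_mult rowder_add mpoly_rowder mpoly.mpoly_mult algebra_simps)
qed

text \<open>Abstracts the coefficient of \<gamma> to the power \<open>e = q + 1\<close>, with one
  row for each factor of the product. \<open>bound1\<close> and \<open>bound2\<close> are the weight
  bounds for one form and for \<open>q - 1\<close> forms; the final \<open>- 1\<close> in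
  \<open>bound2\<close> encodes the strict inequality.\<close>

locale symmetric_rows =
  fixes f :: "cmat \<Rightarrow> complex" and q e :: nat
  assumes poly: "mpoly f" and odd: "odd e" and q: "2 \<le> q"
    and sym: "i < q \<Longrightarrow> j < q \<Longrightarrow> f (swaprow i j x) = f x"
    and hom: "i < q \<Longrightarrow> f (scalerow i c x) = c ^ e * f x"
    and bound1: "degree_at_most (\<lambda>c. f (\<lambda>j l. y j l + c * (s j * u l))) (e + 1)"
    and bound2: "degree_at_most (\<lambda>c. f (\<lambda>j l. y j l + c * (\<Sum>k<q - 1. z j k * w k l)))
                   ((q - 1) * (e + 1) - 1)"
begin

text \<open>Multiplying row \<open>i\<close> by the parameter \<open>t\<close> as well makes all
  rows move along the single vector \<open>x i\<close>. Then \<open>bound1\<close> limits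
  \<open>t ^ e * poly P t\<close> to degree \<open>e + 1\<close>, so \<open>P\<close> is
  affine.\<close>

lemma line_affine:
  assumes "i < q" "s i = 0"
  shows "f (\<lambda>j l. x j l + c * (s j * x i l)) = f x + c * (f (\<lambda>j l. x j l + s j * x i l) - f x)"
proof -
  obtain P where P: "\<forall>t. f (\<lambda>j l. x j l + t * (s j * x i l)) = poly P t"
    using mpoly_line[OF poly, of x "\<lambda>j l. s j * x i l"] by blast
  let ?y = "\<lambda>j l. if j = i then 0 else x j l" and ?s = "s(i := 1)"
  have "(\<lambda>j l. ?y j l + t * (?s j * x i l)) = scalerow i t (\<lambda>j l. x j l + t * (s j * x i l))" for t
    using assms by (auto simp: scalerow_def fun_eq_iff)
  then have "f (\<lambda>j l. ?y j l + t * (?s j * x i l)) = t ^ e * poly P t" for t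
    by (simp only: hom[OF assms(1)] P[rule_format])
  then have "degree P \<le> 1"
    by (rule degree_at_most_cancel[OF bound1[of ?y ?s "x i"]])
  then have "poly P t = coeff P 0 + t * coeff P 1" for t
    using poly_eq_sum[of P 1 t] by simp
  then show ?thesis
    using P[rule_format, of c] P[rule_format, of 0] P[rule_format, of 1] by simp
qed

text \<open>The point with coefficients \<open>(s + s') / 2\<close> is the midpoint of two segments,
  from \<open>0\<close> to \<open>s + s'\<close> and from \<open>s\<close> to \<open>s'\<close>, and
  \<open>f\<close> is affine on both.\<close>

lemma line_additive:
  assumes "i < q" "s i = 0" "s' i = 0"
  shows "f (\<lambda>j l. x j l + (s j + s' j) * x i l) =
    f (\<lambda>j l. x j l + s j * x i l) + f (\<lambda>j l. x j l + s' j * x i l) - f x"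
proof -
  let ?x = "\<lambda>j l. x j l + s j * x i l"
  have "f (\<lambda>j l. ?x j l + (1/2) * ((s' j - s j) * ?x i l)) =
      f ?x + (1/2) * (f (\<lambda>j l. ?x j l + (s' j - s j) * ?x i l) - f ?x)"
    using assms by (intro line_affine) auto
  moreover have "(\<lambda>j l. ?x j l + (1/2) * ((s' j - s j) * ?x i l)) =
      (\<lambda>j l. x j l + (1/2) * ((s j + s' j) * x i l))"
    using assms by (auto simp: fun_eq_iff field_simps)
  moreover have "(\<lambda>j l. ?x j l + (s' j - s j) * ?x i l) = (\<lambda>j l. x j l + s' j * x i l)"
    using assms by (auto simp: fun_eq_iff field_simps)
  moreover have "f (\<lambda>j l. x j l + (1/2) * ((s j + s' j) * x i l)) =
      f x + (1/2) * (f (\<lambda>j l. x j l + (s j + s' j) * x i l) - f x)"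
    using assms by (intro line_affine) auto
  ultimately show ?thesis by (simp add: field_simps)
qed

lemma addrow_affine:
  assumes "i < q" "i \<noteq> j"
  shows "f (addrow i j t x) = f x + t * (f (addrow i j 1 x) - f x)"
proof -
  let ?s = "\<lambda>a. if a = j then 1 else 0"
  have "addrow i j t x = (\<lambda>a l. x a l + t * (?s a * x i l))" for t
    by (auto simp: addrow_def fun_eq_iff)
  moreover have "addrow i j 1 x = (\<lambda>a l. x a l + ?s a * x i l)"
    by (auto simp: addrow_def fun_eq_iff)
  ultimately show ?thesis
    using line_affine[of i ?s x t] assms by simp
qed

lemma rowder_affineI:
  assumes "\<And>t. h (addrow i j t x) = h x + t * d"
  shows "rowder i j h x = d"
  by (subst rowder_eqI[where P = "[:h x, d:]"]) (auto simp: assms)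

lemma rowder_f:
  assumes "i < q" "i \<noteq> j"
  shows "rowder i j f x = f (addrow i j 1 x) - f x"
  using addrow_affine[OF assms] by (rule rowder_affineI)

lemma addrow_f:
  assumes "i < q" "i \<noteq> j"
  shows "f (addrow i j t x) = f x + t * rowder i j f x"
  unfolding rowder_f[OF assms] by (rule addrow_affine[OF assms])

text \<open>Moving a scaling through a row operation only rescales the parameter of the latter. This
  and the next two lemmas find the degree of \<open>rowder i p f\<close> in each row:
  \<open>e - 1\<close> in the target \<open>p\<close>, \<open>e + 1\<close> in the source
  \<open>i\<close>, and \<open>e\<close> elsewhere.\<close>

lemma rowder_scalerow_target:
  assumes "i < q" "p < q" "i \<noteq> p" "c \<noteq> 0"
  shows "rowder i p f (scalerow p c x) = c ^ (e - 1) * rowder i p f x"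
proof -
  have "addrow i p 1 (scalerow p c x) = scalerow p c (addrow i p (1 / c) x)"
    using assms by (auto simp: addrow_def scalerow_def fun_eq_iff field_simps)
  then have "rowder i p f (scalerow p c x) = c ^ e * (f (addrow i p (1 / c) x) - f x)"
    unfolding rowder_f[OF assms(1,3)] by (simp add: hom assms(2) right_diff_distrib)
  also have "\<dots> = c ^ e * (1 / c) * rowder i p f x"
    unfolding addrow_f[OF assms(1,3)] by simp
  also have "c ^ e * (1 / c) = c ^ (e - 1)"
    using odd assms(4) by (cases e) auto
  finally show ?thesis .
qed

lemma rowder_scalerow_source:
  assumes "i < q" "i \<noteq> p"
  shows "rowder i p f (scalerow i c x) = c ^ (e + 1) * rowder i p f x"
proof -
  have "addrow i p 1 (scalerow i c x) = scalerow i c (addrow i p c x)"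
    using assms by (auto simp: addrow_def scalerow_def fun_eq_iff field_simps)
  then have "rowder i p f (scalerow i c x) = c ^ e * (f (addrow i p c x) - f x)"
    unfolding rowder_f[OF assms] by (simp add: hom assms(1) right_diff_distrib)
  also have "\<dots> = c ^ (e + 1) * rowder i p f x"
    unfolding addrow_f[OF assms] by simp
  finally show ?thesis .
qed

lemma rowder_scalerow_other:
  assumes "i < q" "i \<noteq> p" "k < q" "k \<noteq> i" "k \<noteq> p"
  shows "rowder i p f (scalerow k c x) = c ^ e * rowder i p f x"
proof -
  have "addrow i p 1 (scalerow k c x) = scalerow k c (addrow i p 1 x)"
    using assms by (auto simp: addrow_def scalerow_def fun_eq_iff field_simps)
  then show ?thesis
    unfolding rowder_f[OF assms(1,2)] by (simp add: hom assms(3) right_diff_distrib)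
qed

text \<open>By \<open>line_additive\<close>, adding multiples of row \<open>i\<close> to row
  \<open>k\<close> and to row \<open>p\<close> changes \<open>f\<close> by independent
  amounts.\<close>

lemma rowder_addrow_source:
  assumes "k < q" "i < q" "k \<noteq> i" "k \<noteq> p" "i \<noteq> p"
  shows "rowder i p f (addrow i k t x) = rowder i p f x"
proof -
  let ?s = "\<lambda>a. if a = k then t else 0" and ?s' = "\<lambda>a. if a = p then 1 else 0"
  have 1: "addrow i p 1 (addrow i k t x) = (\<lambda>j l. x j l + (?s j + ?s' j) * x i l)"
    and 2: "addrow i k t x = (\<lambda>j l. x j l + ?s j * x i l)"
    and 3: "addrow i p 1 x = (\<lambda>j l. x j l + ?s' j * x i l)"
    using assms by (auto simp: addrow_def fun_eq_iff)
  have "f (addrow i p 1 (addrow i k t x)) = f (addrow i k t x) + f (addrow i p 1 x) - f x"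
    by (subst 1, subst 2, subst 3, rule line_additive) (use assms in auto)
  then show ?thesis
    unfolding rowder_f[OF assms(2,5)] by simp
qed

text \<open>After row \<open>i\<close> has been added to row \<open>p\<close>, the operation on row
  \<open>i\<close> moves rows \<open>i\<close> and \<open>p\<close> together along row
  \<open>k\<close>, a line covered by \<open>line_affine\<close>.\<close>

lemma rowder_addrow_affine:
  assumes "k < q" "i < q" "k \<noteq> i" "k \<noteq> p" "i \<noteq> p"
  shows "rowder i p f (addrow k i t x) =
    rowder i p f x + t * rowder k i (rowder i p f) x"
proof -
  have *: "rowder i p f (addrow k i t x) =
    rowder i p f x + t * (rowder i p f (addrow k i 1 x) - rowder i p f x)" for t
  proof -
    note f = rowder_f[OF assms(2,5)]
    let ?y = "addrow i p 1 x" and ?s = "\<lambda>a. if a = i \<or> a = p then 1 else 0"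
    have "addrow i p 1 (addrow k i t x) = (\<lambda>j l. ?y j l + t * (?s j * ?y k l))" for t
      using assms by (auto simp: addrow_def fun_eq_iff algebra_simps)
    moreover have "addrow i p 1 (addrow k i 1 x) = (\<lambda>j l. ?y j l + ?s j * ?y k l)"
      using assms by (auto simp: addrow_def fun_eq_iff algebra_simps)
    ultimately have "f (addrow i p 1 (addrow k i t x)) =
        f ?y + t * (f (addrow i p 1 (addrow k i 1 x)) - f ?y)"
      using line_affine[of k ?s ?y t] assms by simp
    then show ?thesis
      unfolding f addrow_affine[OF assms(1,3), of t] by (simp add: algebra_simps)
  qed
  have "rowder k i (rowder i p f) x = rowder i p f (addrow k i 1 x) - rowder i p f x"
    by (rule rowder_affineI) (rule *)
  then show ?thesis
    by (simp only: *[of t])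
qed

text \<open>Adding a multiple of row \<open>k\<close> to row \<open>i\<close>, and then one of row
  \<open>i\<close> to row \<open>k\<close>, which leaves \<open>rowder i p f\<close> unchanged,
  amounts to a swap, scalings and one row operation. The odd \<open>e\<close> supplies a sign;
  comparing coefficients of \<open>t\<close> gives the claim.\<close>

lemma rowder_chain:
  assumes "k < q" "i < q" "p < q" "k \<noteq> i" "k \<noteq> p" "i \<noteq> p"
  shows "rowder k i (rowder i p f) x = - rowder k p f x"
proof -
  let ?h = "rowder i p f"
  let ?H = "rowder k i ?h" and ?y = "swaprow i k x"
  have *: "?h x + t * ?H x = - t * ?h ?y - ?H ?y" if "t \<noteq> 0" for t
  proof -
    have "?h x + t * ?H x = ?h (addrow k i t x)"
      using assms by (simp add: rowder_addrow_affine)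
    also have "\<dots> = ?h (addrow i k (- (1 / t)) (addrow k i t x))"
      using assms by (simp add: rowder_addrow_source)
    \<comment> \<open>On both sides row \<open>k\<close> is \<open>- 1 / t\<close> times
      \<open>x i\<close>, and row \<open>i\<close> is \<open>t\<close> times
      \<open>x k + (1 / t) x i\<close>.\<close>
    also have "addrow i k (- (1 / t)) (addrow k i t x) =
        scalerow k (- (1 / t)) (scalerow i t (addrow k i (1 / t) ?y))"
      using assms that by (auto simp: addrow_def scalerow_def swaprow_def fun_eq_iff field_simps)
    also have "?h \<dots> = ((- (1 / t)) ^ e * t ^ (e + 1)) * (?h ?y + (1 / t) * ?H ?y)"
      using assms by (simp add: rowder_scalerow_other rowder_scalerow_source rowder_addrow_affine)
    also have "(- (1 / t)) ^ e * t ^ (e + 1) = - t"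
      using odd that by (simp add: power_one_over)
    also have "- t * (?h ?y + 1 / t * ?H ?y) = - t * ?h ?y - ?H ?y"
      using that by (simp add: distrib_left)
    finally show ?thesis .
  qed
  have "?H x = - ?h ?y"
  proof -
    \<comment> \<open>The identity \<open>*\<close> at \<open>t = 2\<close> minus the one at
      \<open>t = 1\<close>.\<close>
    have "?H x = (?h x + 2 * ?H x) - (?h x + 1 * ?H x)"
      by simp
    also have "\<dots> = - ?h ?y"
      by (subst *, simp, subst *) simp_all
    finally show ?thesis .
  qed
  moreover have "addrow i p 1 ?y = swaprow i k (addrow k p 1 x)"
    using assms by (auto simp: addrow_def swaprow_def fun_eq_iff)
  ultimately show ?thesis
    using assms by (simp add: rowder_f sym)
qed

text \<open>The claim concerns the linear coefficient of \<open>Q\<close>, the restriction of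
  \<open>rowder i p f\<close> to a row operation. Symmetry determines the differences of
  \<open>Q\<close> and \<open>bound1\<close> limits its degree to 2, which together fix that
  coefficient.\<close>

lemma rowder_back:
  assumes "i < q" "p < q" "i \<noteq> p"
  shows "rowder p i (rowder i p f) x = 2 * f x"
proof -
  let ?h = "rowder i p f"
  obtain Q where Q: "\<forall>t. ?h (addrow p i t x) = poly Q t"
    using mpoly_addrow[OF mpoly_rowder[OF poly]] by blast
  have step: "poly Q t - poly Q (t - 1) = 2 * f x + (2 * t - 1) * rowder p i f x" for t
  proof -
    let ?b = "addrow p i t x" and ?a = "addrow p i (t - 1) x"
    \<comment> \<open>A swap and a sign turn \<open>?b\<close> into \<open>?z\<close>; one row
      operation then takes \<open>?a\<close> and \<open>?z\<close> to the same matrix, which links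
      the values of \<open>Q\<close> at \<open>t - 1\<close> and \<open>t\<close>.\<close>
    let ?z = "swaprow i p (scalerow p (- 1) ?b)"
    have "addrow i p 1 ?a = addrow p i 1 ?z"
      using assms by (auto simp: addrow_def scalerow_def swaprow_def fun_eq_iff algebra_simps)
    then have "poly Q (t - 1) = f (addrow p i 1 ?z) - f ?a"
      using assms by (simp add: Q[rule_format, symmetric] rowder_f)
    also have "addrow p i 1 ?z = swaprow i p (addrow i p 1 (scalerow p (- 1) ?b))"
      using assms by (auto simp: addrow_def scalerow_def swaprow_def fun_eq_iff algebra_simps)
    also have "f \<dots> = f (scalerow p (- 1) ?b) + ?h (scalerow p (- 1) ?b)"
      using assms by (simp add: sym rowder_f)
    also have "\<dots> = - f ?b + poly Q t"
      using assms odd by (simp add: hom rowder_scalerow_target Q)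
    finally show ?thesis
      using assms by (simp add: addrow_f algebra_simps)
  qed
  have "degree Q \<le> 2"
  proof (rule degree_at_most_cancel[of _ "e - 1"])
    \<comment> \<open>Base points of two lines along \<open>x p\<close>: the difference of
      \<open>f\<close> on them is \<open>c ^ (e - 1) * poly Q c\<close>, while \<open>bound1\<close>
      limits each to degree \<open>e + 1\<close>.\<close>
    let ?y = "\<lambda>a l. if a = p then 0 else x a l" and ?s = "\<lambda>a. if a = i \<or> a = p then 1 else 0"
    let ?y' = "\<lambda>a l. if a = p then x i l else x a l" and ?s' = "\<lambda>a. if a = p then 2 else if a = i then 1 else 0"
    have "degree_at_most (\<lambda>c. f (\<lambda>j l. ?y' j l + c * (?s' j * x p l)) -
        f (\<lambda>j l. ?y j l + c * (?s j * x p l))) (e + 1)"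
      by (intro degree_at_most_diff bound1)
    moreover have "e + 1 = e - 1 + 2"
      using odd odd_pos by fastforce
    ultimately show "degree_at_most (\<lambda>c. f (\<lambda>j l. ?y' j l + c * (?s' j * x p l)) -
        f (\<lambda>j l. ?y j l + c * (?s j * x p l))) (e - 1 + 2)"
      by simp
    fix c :: complex assume "c \<noteq> 0"
    have 1: "(\<lambda>j l. ?y j l + c * (?s j * x p l)) = scalerow p c (addrow p i c x)"
      and 2: "(\<lambda>j l. ?y' j l + c * (?s' j * x p l)) = addrow i p 1 (scalerow p c (addrow p i c x))"
      using assms by (auto simp: addrow_def scalerow_def fun_eq_iff algebra_simps)
    show "f (\<lambda>j l. ?y' j l + c * (?s' j * x p l)) - f (\<lambda>j l. ?y j l + c * (?s j * x p l)) =
        c ^ (e - 1) * poly Q c"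
      unfolding 1 2 rowder_f[OF assms(1,3), symmetric]
      by (simp only: rowder_scalerow_target[OF assms \<open>c \<noteq> 0\<close>] Q[rule_format])
  qed
  then have "poly Q t = coeff Q 0 + t * coeff Q 1 + t ^ 2 * coeff Q 2" for t
    using poly_eq_sum[of Q 2 t] by (simp add: numeral_2_eq_2 algebra_simps)
  \<comment> \<open>In this combination of the differences at 0 and 2, \<open>coeff Q 2\<close>
    cancels, and after applying \<open>step\<close> so does \<open>rowder p i f\<close>.\<close>
  then have "4 * coeff Q 1 = 3 * (poly Q 0 - poly Q (0 - 1)) + (poly Q 2 - poly Q (2 - 1))"
    by (simp add: power2_eq_square algebra_simps)
  then have "coeff Q 1 = 2 * f x"
    unfolding step by (simp add: algebra_simps)
  then show ?thesis
    by (simp only: rowder_eqI[OF Q[rule_format]])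
qed

section \<open>Products of the operators that act on the last row\<close>

abbreviation last_row :: nat where "last_row \<equiv> q - 1"

abbreviation raise :: "nat list \<Rightarrow> (cmat \<Rightarrow> complex) \<Rightarrow> cmat \<Rightarrow> complex" where
  "raise ks h \<equiv> foldr (\<lambda>k. rowder k last_row) ks h"

lemma mpoly_raise: "mpoly h \<Longrightarrow> mpoly (raise ks h)"
  by (induction ks) (auto intro: mpoly_rowder)

text \<open>The operator commutes with every factor \<open>rowder l last_row\<close>, since
  \<open>l \<noteq> i\<close>, and reaches the innermost one, where \<open>rowder_chain\<close>
  applies.\<close>

lemma rowder_raise_chain:
  assumes "i < last_row" "k < last_row" "k \<noteq> i" "set ks \<subseteq> {..<last_row} - {i}"
  shows "rowder k i (raise ks (rowder i last_row f)) = (\<lambda>x. - rowder k last_row (raise ks f) x)"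
  using assms(4)
proof (induction ks)
  case Nil
  show ?case using assms q by (auto simp: rowder_chain)
next
  case (Cons l ks)
  have "rowder k i (rowder l last_row (raise ks (rowder i last_row f))) =
      rowder l last_row (rowder k i (raise ks (rowder i last_row f)))"
    using Cons.prems assms by (intro rowder_commute mpoly_raise mpoly_rowder poly) auto
  also have "\<dots> = rowder l last_row (\<lambda>x. (- 1) * rowder k last_row (raise ks f) x)"
    using Cons by simp
  also have "\<dots> = (\<lambda>x. - rowder l last_row (rowder k last_row (raise ks f)) x)"
    by (subst rowder_cmult[OF mpoly_rowder[OF mpoly_raise[OF poly]]]) simp
  also have "rowder l last_row (rowder k last_row (raise ks f)) =
      rowder k last_row (rowder l last_row (raise ks f))"
    using Cons.prems assms by (intro rowder_commute mpoly_raise poly) auto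
  finally show ?case by simp
qed

text \<open>Passing a factor \<open>rowder k last_row\<close> costs a commutator
  \<open>- rowder k i\<close>, which by \<open>rowder_raise_chain\<close> yields one more copy of
  the product; \<open>rowder_back\<close> yields the other two.\<close>

lemma rowder_raise_back:
  assumes "i < last_row" "set ks \<subseteq> {..<last_row} - {i}"
  shows "rowder last_row i (raise ks (rowder i last_row f)) = (\<lambda>x. (of_nat (length ks) + 2) * raise ks f x)"
  using assms(2)
proof (induction ks)
  case Nil
  show ?case using assms q by (auto simp: rowder_back)
next
  case (Cons k ks)
  let ?g = "raise ks (rowder i last_row f)"
  have "rowder last_row i (rowder k last_row ?g) =
      (\<lambda>x. rowder k last_row (rowder last_row i ?g) x - rowder k i ?g x)"
    using Cons.prems by (intro rowder_commutator mpoly_raise mpoly_rowder poly) auto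
  also have "rowder last_row i ?g = (\<lambda>x. (of_nat (length ks) + 2) * raise ks f x)"
    using Cons by simp
  also have "rowder k last_row \<dots> = (\<lambda>x. (of_nat (length ks) + 2) * rowder k last_row (raise ks f) x)"
    by (intro rowder_cmult mpoly_raise poly)
  also have "rowder k i ?g = (\<lambda>x. - rowder k last_row (raise ks f) x)"
    using Cons.prems assms by (intro rowder_raise_chain) auto
  finally show ?case by (simp add: algebra_simps)
qed

text \<open>The products \<open>raise ks f\<close> are iterated differences of these functions,
  which carries \<open>bound2\<close> over from \<open>f\<close> to its derivatives.\<close>

definition shifted :: "(nat \<Rightarrow> complex) \<Rightarrow> cmat \<Rightarrow> complex" where
  "shifted s x = f (\<lambda>j l. if j = last_row then x j l + (\<Sum>k<last_row. s k * x k l) else x j l)"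

definition scale_init :: "complex \<Rightarrow> cmat \<Rightarrow> cmat" where
  "scale_init c x = (\<lambda>j l. if j < last_row then c * x j l else x j l)"

inductive shift_comb :: "(cmat \<Rightarrow> complex) \<Rightarrow> bool" where
  shift_comb_base: "shift_comb (shifted s)"
| shift_comb_diff: "shift_comb g \<Longrightarrow> shift_comb h \<Longrightarrow> shift_comb (\<lambda>x. g x - h x)"

text \<open>The row operation changes a single shift coefficient, in which \<open>f\<close> is
  affine by \<open>addrow_affine\<close>; so the derivative is a difference of two shifts.\<close>

lemma shift_comb_mpoly_affine:
  assumes "shift_comb g" "k < last_row"
  shows "shift_comb (rowder k last_row g) \<and>
    (\<forall>x t. g (addrow k last_row t x) = g x + t * rowder k last_row g x)"
  using assms(1)
proof induction
  case (shift_comb_base s)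
  let ?s = "\<lambda>t. s(k := s k + t)"
  have sh: "shifted s (addrow k last_row t x) = shifted (?s t) x" for t x
  proof -
    have "x last_row l + t * x k l + (\<Sum>k<last_row. s k * x k l) =
        x last_row l + (\<Sum>k'<last_row. ?s t k' * x k' l)" for l
    proof -
      have "(\<Sum>k'<last_row. ?s t k' * x k' l) =
          (\<Sum>k'<last_row. s k' * x k' l + (if k' = k then t * x k l else 0))"
        by (intro sum.cong) (auto simp: algebra_simps)
      then show ?thesis
        using assms by (simp add: sum.distrib)
    qed
    then show ?thesis
      unfolding shifted_def addrow_def using assms
      by (intro arg_cong[of _ _ f] ext) (auto intro!: sum.cong)
  qed
  have aff: "shifted s (addrow k last_row t x) = shifted s x + t * (shifted (?s 1) x - shifted s x)" for t x
  proof -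
    let ?x = "\<lambda>j l. if j = last_row then x j l + (\<Sum>k<last_row. s k * x k l) else x j l"
    have "shifted s (addrow k last_row t x) = f (addrow k last_row t ?x)" for t
      unfolding shifted_def using assms
      by (intro arg_cong[of _ _ f] ext) (auto simp: addrow_def intro!: sum.cong)
    moreover have "shifted s x = f ?x" by (simp add: shifted_def)
    ultimately show ?thesis
      using addrow_affine[of k last_row t ?x] assms sh[of 1 x] by simp
  qed
  have "rowder k last_row (shifted s) = (\<lambda>x. shifted (?s 1) x - shifted s x)"
    by (intro ext rowder_affineI) (rule aff)
  then show ?case
    using aff by (auto intro: shift_comb.intros)
next
  case (shift_comb_diff g h)
  have aff: "g (addrow k last_row t x) - h (addrow k last_row t x) =
      g x - h x + t * (rowder k last_row g x - rowder k last_row h x)" for t x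
    using shift_comb_diff.IH by (simp add: algebra_simps)
  have "rowder k last_row (\<lambda>x. g x - h x) = (\<lambda>x. rowder k last_row g x - rowder k last_row h x)"
    by (intro ext rowder_affineI) (rule aff)
  then show ?case
    using aff shift_comb_diff.IH by (auto intro: shift_comb.intros)
qed

lemma shift_comb_raise:
  "set ks \<subseteq> {..<last_row} \<Longrightarrow> shift_comb (raise ks f)"
proof (induction ks)
  case Nil
  have "shifted (\<lambda>_. 0) = f"
    unfolding shifted_def by (rule ext, rule arg_cong[of _ _ f]) (simp add: fun_eq_iff)
  then show ?case using shift_comb_base[of "\<lambda>_. 0"] by simp
next
  case (Cons k ks)
  then have "shift_comb (raise ks f)" "k < last_row"
    by simp_all
  then show ?case
    unfolding foldr.simps o_apply by (rule shift_comb_mpoly_affine[THEN conjunct1])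
qed

text \<open>All rows, including the shift in the last one, move along combinations of the first
  \<open>q - 1\<close> rows, so \<open>bound2\<close> applies.\<close>

lemma shift_comb_bound:
  "shift_comb g \<Longrightarrow> degree_at_most (\<lambda>c. g (scale_init c x)) ((q - 1) * (e + 1) - 1)"
proof (induction rule: shift_comb.induct)
  case (shift_comb_base s)
  let ?y = "\<lambda>j l. if j < last_row then 0 else x j l"
  let ?z = "\<lambda>j k. if j = last_row then s k else if j = k then 1 else 0"
  have "(\<Sum>k<q - 1. ?z j k * x k l) = x j l" if "j < last_row" for j l
  proof -
    have "(\<Sum>k<q - 1. ?z j k * x k l) = (\<Sum>k<q - 1. if k = j then x j l else 0)"
      using that by (intro sum.cong) auto
    then show ?thesis using that by simp
  qed
  moreover have "(\<Sum>k<q - 1. s k * (c * x k l)) = c * (\<Sum>k<q - 1. s k * x k l)" for c l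
    by (simp add: sum_distrib_left mult.left_commute)
  ultimately have "shifted s (scale_init c x) = f (\<lambda>j l. ?y j l + c * (\<Sum>k<q - 1. ?z j k * x k l))" for c
    unfolding shifted_def scale_init_def
    by (intro arg_cong[of _ _ f] ext) simp
  then show ?case
    using bound2[of ?y ?z x] by simp
qed (rule degree_at_most_diff)

lemma scale_init_f: "f (scale_init c x) = c ^ ((q - 1) * e) * f x"
proof -
  have "f (\<lambda>j l. if j < n then c * x j l else x j l) = c ^ (n * e) * f x" if "n \<le> q" for n
    using that
  proof (induction n)
    case (Suc n)
    have "(\<lambda>j l. if j < Suc n then c * x j l else x j l) =
        scalerow n c (\<lambda>j l. if j < n then c * x j l else x j l)"
      by (auto simp: scalerow_def fun_eq_iff)
    then show ?case using Suc by (simp add: hom power_add)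
  qed simp
  then show ?thesis by (simp add: scale_init_def)
qed

text \<open>Each factor trades an occurrence of the last row for one of a scaled row.\<close>

lemma scale_init_raise:
  assumes "set ks \<subseteq> {..<last_row}"
  shows "raise ks f (scale_init c x) = c ^ ((q - 1) * e + length ks) * raise ks f x"
  using assms
proof (induction ks arbitrary: x)
  case Nil
  show ?case by (simp add: scale_init_f)
next
  case (Cons k ks)
  let ?g = "raise ks f"
  have k: "k < last_row" using Cons by simp
  have g: "?g (addrow k last_row t y) = ?g y + t * rowder k last_row ?g y" for t y
    by (rule shift_comb_mpoly_affine[OF shift_comb_raise k, THEN conjunct2, rule_format])
      (use Cons.prems in simp)
  have "addrow k last_row 1 (scale_init c x) = scale_init c (addrow k last_row c x)"
    using k by (auto simp: addrow_def scale_init_def fun_eq_iff)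
  then have "?g (scale_init c x) + rowder k last_row ?g (scale_init c x) = ?g (scale_init c (addrow k last_row c x))"
    using g[of 1 "scale_init c x"] by simp
  moreover have "?g (scale_init c y) = c ^ ((q - 1) * e + length ks) * ?g y" for y
    using Cons by simp
  ultimately have "c ^ ((q - 1) * e + length ks) * ?g x + rowder k last_row ?g (scale_init c x) =
      c ^ ((q - 1) * e + length ks) * (?g x + c * rowder k last_row ?g x)"
    by (simp only: g)
  then show ?case
    by (simp add: distrib_left)
qed

text \<open>With \<open>q - 1\<close> factors the degree in the first \<open>q - 1\<close> rows is
  \<open>(q - 1) * (e + 1)\<close>, one more than \<open>bound2\<close> permits.\<close>

lemma raise_all_eq_0: "raise [0..<last_row] f x = 0"
proof -
  let ?g = "raise [0..<last_row] f"
  have "degree_at_most (\<lambda>c. ?g (scale_init c x)) ((q - 1) * (e + 1) - 1)"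
    by (intro shift_comb_bound shift_comb_raise) auto
  then obtain P where P: "degree P \<le> (q - 1) * (e + 1) - 1" "\<And>c. ?g (scale_init c x) = poly P c"
    by (rule degree_at_mostE) blast
  have "?g (scale_init c x) = c ^ ((q - 1) * e + length [0..<last_row]) * ?g x" for c
    by (rule scale_init_raise) auto
  then have "poly P c = ?g x * c ^ ((q - 1) * (e + 1))" for c
    by (simp add: P(2)[symmetric] algebra_simps del: One_nat_def)
  then have "P = monom (?g x) ((q - 1) * (e + 1))"
    by (intro poly_eq_if_eq_nonzero) (simp only: poly_monom)
  moreover have "(q - 1) * (e + 1) > 0"
    using q by simp
  ultimately show ?thesis
    using P(1) degree_monom_eq[of "?g x" "(q - 1) * (e + 1)"]
    by (metis One_nat_def Suc_pred not_less_eq_eq order_refl)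
qed

theorem eq_0: "f = (\<lambda>_. 0)"
proof -
  have "raise [0..<last_row - n] f = (\<lambda>_. 0)" if "n \<le> last_row" for n
    using that
  proof (induction n)
    case 0
    show ?case using raise_all_eq_0 by auto
  next
    case (Suc n)
    let ?i = "last_row - Suc n"
    have "[0..<last_row - n] = [0..<?i] @ [?i]"
      using Suc.prems by (metis Suc_diff_Suc Suc_le_lessD le0 upt_Suc_append)
    then have "raise [0..<?i] (rowder ?i last_row f) = (\<lambda>_. 0)"
      using Suc by simp
    moreover have "?i < last_row" "set [0..<?i] \<subseteq> {..<last_row} - {?i}"
      using Suc.prems by auto
    \<comment> \<open>Applying \<open>rowder last_row ?i\<close> to the zero function removes the
      innermost factor, up to the nonzero scalar \<open>?i + 2\<close>.\<close>
    ultimately have "(\<lambda>x. (of_nat (length [0..<?i]) + 2) * raise [0..<?i] f x) = (\<lambda>_. 0)"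
      using rowder_raise_back by (metis rowder_const)
    then have "(of_nat (length [0..<?i]) + 2) * raise [0..<?i] f x = 0" for x
      by (rule fun_cong)
    moreover have "(of_nat (length [0..<?i]) + 2 :: complex) \<noteq> 0"
      by (metis add_2_eq_Suc' nat.distinct(1) of_nat_add of_nat_eq_0_iff of_nat_numeral)
    ultimately show ?case
      by (intro ext) (simp only: mult_eq_0_iff simp_thms)
  qed
  from this[of last_row] show ?thesis by simp
qed

end

section \<open>Polynomial families of forms\<close>

interpretation fs: vector_space "fscale :: complex \<Rightarrow> ('a \<Rightarrow> complex) \<Rightarrow> 'a \<Rightarrow> complex"
  by unfold_locales (auto simp: pw_scale_def fun_eq_iff algebra_simps)

text \<open>Finite sums of fixed elements of \<open>A\<close> with polynomial coefficients, so that
  a linear functional on \<open>A\<close> acts on the fixed elements alone.\<close>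

inductive poly_family :: "('a \<Rightarrow> complex) set \<Rightarrow> (cmat \<Rightarrow> 'a \<Rightarrow> complex) \<Rightarrow> bool" for A where
  zero: "poly_family A (\<lambda>_ _. 0)"
| step: "mpoly m \<Longrightarrow> Q \<in> A \<Longrightarrow> poly_family A P \<Longrightarrow> poly_family A (\<lambda>x v. m x * Q v + P x v)"

lemma poly_family_const: "Q \<in> A \<Longrightarrow> poly_family A (\<lambda>_. Q)"
  using poly_family.step[OF mpoly_const[of 1] _ poly_family.zero, of Q A] by simp

lemma poly_family_add:
  assumes "poly_family A P" "poly_family A Q"
  shows "poly_family A (\<lambda>x v. P x v + Q x v)"
  using assms(1)
proof induction
  case (step m R P)
  have "poly_family A (\<lambda>x v. m x * R v + (P x v + Q x v))"
    using step.hyps(1,2) step.IH by (rule poly_family.step)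
  then show ?case by (simp add: add.assoc)
qed (simp add: assms)

lemma poly_family_mult_mpoly:
  assumes "poly_family A P" "mpoly m"
  shows "poly_family A (\<lambda>x v. m x * P x v)"
  using assms(1)
proof induction
  case zero
  show ?case by (simp add: poly_family.zero)
next
  case (step m' R P)
  have "poly_family A (\<lambda>x v. (m x * m' x) * R v + m x * P x v)"
    by (intro poly_family.step mpoly_mult assms step.hyps step.IH)
  then show ?case by (simp add: algebra_simps)
qed

lemma poly_family_sum:
  "\<forall>k<n::nat. poly_family A (P k) \<Longrightarrow> poly_family A (\<lambda>x v. \<Sum>k<n. P k x v)"
proof (induction n)
  case 0
  show ?case by (simp add: poly_family.zero)
next
  case (Suc n)
  then have "poly_family A (\<lambda>x v. (\<Sum>k<n. P k x v) + P n x v)"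
    by (intro poly_family_add) auto
  then show ?case by simp
qed

lemma poly_family_mult:
  assumes "poly_family A P" "poly_family B Q" and "\<And>a b. a \<in> A \<Longrightarrow> b \<in> B \<Longrightarrow> (\<lambda>v. a v * b v) \<in> C"
  shows "poly_family C (\<lambda>x v. P x v * Q x v)"
  using assms(1)
proof induction
  case zero
  show ?case by (simp add: poly_family.zero)
next
  case (step m R P)
  have "poly_family C (\<lambda>x v. R v * Q x v)"
    using assms(2)
  proof induction
    case zero
    show ?case by (simp add: poly_family.zero)
  next
    case (step m' R' P')
    have "poly_family C (\<lambda>x v. m' x * (R v * R' v) + R v * P' x v)"
      by (intro poly_family.step[of m' "\<lambda>v. R v * R' v"] assms(3) step.hyps step.IH \<open>R \<in> A\<close>)
    then show ?case by (simp add: algebra_simps)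
  qed
  then have "poly_family C (\<lambda>x v. m x * (R v * Q x v) + P x v * Q x v)"
    by (intro poly_family_add poly_family_mult_mpoly step.hyps step.IH)
  then show ?case by (simp add: algebra_simps)
qed

lemma poly_family_in:
  assumes "poly_family A P" "fs.subspace A"
  shows "P x \<in> A"
  using assms(1)
proof induction
  case zero
  have "0 \<in> A" using assms(2) by (rule fs.subspace_0)
  then show ?case by (simp add: zero_fun_def)
next
  case (step m Q P)
  have "fscale (m x) Q + P x \<in> A"
    using assms(2) step by (intro fs.subspace_add fs.subspace_scale)
  then show ?case by (simp add: pw_scale_def plus_fun_def)
qed

lemma mpoly_prod: "\<forall>i<n::nat. mpoly (g i) \<Longrightarrow> mpoly (\<lambda>x. \<Prod>i<n. g i x)"
proof (induction n)
  case 0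
  show ?case by (simp add: mpoly_const)
next
  case (Suc n)
  then have "mpoly (\<lambda>x. (\<Prod>i<n. g i x) * g n x)"
    by (intro mpoly_mult) auto
  then show ?case by simp
qed

lemma mpoly_dual:
  assumes "poly_family A P" "fs.subspace A" "l \<in> dual_space fscale A"
  shows "mpoly (\<lambda>x. l (P x))"
  using assms(1)
proof induction
  case zero
  have "l (fscale 0 0) = 0 * l 0"
    using assms(2,3) fs.subspace_0[OF assms(2)] unfolding dual_space_def by blast
  then have "l (\<lambda>_. 0) = 0" by (simp add: pw_scale_def zero_fun_def)
  then show ?case by (simp add: mpoly_const)
next
  case (step m Q P)
  have "l (\<lambda>v. m x * Q v + P x v) = m x * l Q + l (P x)" for x
  proof -
    have "l (fscale (m x) Q + P x) = l (fscale (m x) Q) + l (P x)"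
      using assms(3) fs.subspace_scale[OF assms(2) step.hyps(2)] poly_family_in[OF step.hyps(3) assms(2)]
      unfolding dual_space_def by blast
    also have "l (fscale (m x) Q) = m x * l Q"
      using assms(3) step.hyps(2) unfolding dual_space_def by blast
    finally show ?thesis by (simp add: pw_scale_def plus_fun_def)
  qed
  then show ?case
    by (simp only:) (rule mpoly_add[OF mpoly_mult[OF step.hyps(1) mpoly_const] step.IH])
qed

lemma sym_dual_induct [consumes 1, case_names prod zero add scale]:
  assumes "F \<in> sym_dual sc U k"
    and "\<And>w. \<forall>i<k. w i \<in> dual_space sc U \<Longrightarrow> Pr (\<lambda>x. if x \<in> U then (\<Prod>i<k. w i x) else 0)"
    and "Pr (\<lambda>_. 0)" and "\<And>F G. Pr F \<Longrightarrow> Pr G \<Longrightarrow> Pr (\<lambda>x. F x + G x)"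
    and "\<And>c F. Pr F \<Longrightarrow> Pr (\<lambda>x. c * F x)"
  shows "Pr F"
  using assms(1) unfolding sym_dual_def
proof (induction rule: fs.span_induct_alt)
  case base
  show ?case using assms(3) by (simp add: zero_fun_def)
next
  case (step c x y)
  then obtain w where w: "\<forall>i<k. w i \<in> dual_space sc U" "x = (\<lambda>x. if x \<in> U then (\<Prod>i<k. w i x) else 0)"
    by blast
  have "Pr (\<lambda>v. c * x v + y v)"
    unfolding w(2) by (intro assms(2,4,5) w(1) step(2))
  then show ?case by (simp add: pw_scale_def plus_fun_def)
qed

lemma mpoly_sym_dual:
  assumes "F \<in> sym_dual fscale A k" "fs.subspace A" "poly_family A P"
  shows "mpoly (\<lambda>x. F (P x))"
  using assms(1)
proof (induction rule: sym_dual_induct)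
  case (prod w)
  have "mpoly (\<lambda>x. \<Prod>i<k. w i (P x))"
    using prod by (intro mpoly_prod allI impI mpoly_dual[OF assms(3,2)]) auto
  then show ?case by (simp add: poly_family_in[OF assms(3,2)])
qed (simp_all add: mpoly_const mpoly_add mpoly_mult)

lemma sym_dual_homogeneous:
  assumes "F \<in> sym_dual fscale A k" "fs.subspace A" "P \<in> A"
  shows "F (fscale c P) = c ^ k * F P"
  using assms(1)
proof (induction rule: sym_dual_induct)
  case (prod w)
  have "(\<Prod>i<k. w i (fscale c P)) = (\<Prod>i<k. c * w i P)"
    using prod assms(3) by (intro prod.cong) (auto simp: dual_space_def)
  then show ?case
    using assms fs.subspace_scale[OF assms(2,3)] by (simp add: prod.distrib)
qed (simp_all add: algebra_simps)

lemma subspace_sym_dual: "fs.subspace (sym_dual sc U k)"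
  unfolding sym_dual_def by (rule fs.subspace_span)

context vector_space
begin

lemma GL_I:
  assumes "Vector_Spaces.linear scale scale g" "\<And>v. h (g v) = v" "\<And>v. g (h v) = v"
  shows "g \<in> {g. Vector_Spaces.linear scale scale g \<and> bij g}"
  using assms by (auto intro!: o_bij[of h] simp: fun_eq_iff)

end

section \<open>Linear forms, their products and families of forms\<close>

locale complex_space = finite_dimensional_vector_space scale Basis
  for scale :: "complex \<Rightarrow> 'v::ab_group_add \<Rightarrow> 'v" and Basis :: "'v set"
begin

abbreviation covec :: "('v \<Rightarrow> complex) set" where "covec \<equiv> dual_space scale UNIV"

abbreviation lin :: "('v \<Rightarrow> 'v) \<Rightarrow> bool" where "lin \<equiv> Vector_Spaces.linear scale scale"

lemma linI:
  assumes "\<And>x y. g (x + y) = g x + g y" "\<And>c x. g (scale c x) = scale c (g x)"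
  shows "lin g"
  unfolding Vector_Spaces.linear_iff using assms vector_space_axioms by blast

lemma linD:
  assumes "lin g"
  shows "g (x + y) = g x + g y" "g (scale c x) = scale c (g x)"
  using assms unfolding Vector_Spaces.linear_iff by blast+

lemma covecD:
  assumes "w \<in> covec"
  shows "w (x + y) = w x + w y" "w (scale c x) = c * w x"
  using assms unfolding dual_space_def by blast+

lemma covecI:
  assumes "\<And>x y. w (x + y) = w x + w y" "\<And>c x. w (scale c x) = c * w x"
  shows "w \<in> covec"
  using assms unfolding dual_space_def by blast

lemma covec_comp: "w \<in> covec \<Longrightarrow> lin g \<Longrightarrow> (\<lambda>v. w (g v)) \<in> covec"
  by (rule covecI) (simp_all add: covecD linD)

lemma covec_cmult: "w \<in> covec \<Longrightarrow> (\<lambda>v. c * w v) \<in> covec"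
  by (rule covecI) (simp_all add: covecD algebra_simps)

lemma covec_sum:
  assumes "w \<in> covec"
  shows "w (\<Sum>k\<in>K. scale (a k) (x k)) = (\<Sum>k\<in>K. a k * w (x k))"
proof -
  have "w 0 = 0"
    using covecD(2)[OF assms, of 0 0] by simp
  then show ?thesis
    by (induction K rule: infinite_finite_induct) (simp_all add: covecD[OF assms])
qed

lemma subspace_forms: "fs.subspace (form_space scale d)"
  unfolding form_space_def by (rule subspace_sym_dual)

lemma prod_in_forms: "\<forall>j<d. w j \<in> covec \<Longrightarrow> (\<lambda>v. \<Prod>j<d. w j v) \<in> form_space scale d"
  unfolding form_space_def sym_dual_def by (rule fs.span_base) auto

lemma forms_add:
  "P \<in> form_space scale d \<Longrightarrow> Q \<in> form_space scale d \<Longrightarrow> (\<lambda>v. P v + Q v) \<in> form_space scale d"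
  using fs.subspace_add[OF subspace_forms] by (simp add: plus_fun_def)

lemma forms_cmult: "P \<in> form_space scale d \<Longrightarrow> (\<lambda>v. c * P v) \<in> form_space scale d"
  using fs.subspace_scale[OF subspace_forms] by (simp add: pw_scale_def)

lemma forms_zero: "(\<lambda>_. 0) \<in> form_space scale d"
  using fs.subspace_0[OF subspace_forms] by (simp add: zero_fun_def)

lemma forms_induct [consumes 1, case_names prod zero add scale]:
  assumes "P \<in> form_space scale d"
    and "\<And>w. \<forall>i<d. w i \<in> covec \<Longrightarrow> Pr (\<lambda>v. \<Prod>i<d. w i v)"
    and "Pr (\<lambda>_. 0)" and "\<And>F G. Pr F \<Longrightarrow> Pr G \<Longrightarrow> Pr (\<lambda>x. F x + G x)"
    and "\<And>c F. Pr F \<Longrightarrow> Pr (\<lambda>x. c * F x)"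
  shows "Pr P"
  using assms(1) unfolding form_space_def
proof (induction rule: sym_dual_induct)
  case (prod w)
  then show ?case using assms(2) by simp
qed (use assms(3-) in blast)+

lemma forms_mult_covec:
  assumes "P \<in> form_space scale d" "u \<in> covec"
  shows "(\<lambda>v. P v * u v) \<in> form_space scale (Suc d)"
  using assms(1)
proof (induction rule: forms_induct)
  case (prod w)
  have "(\<lambda>v. \<Prod>i<Suc d. (w(d := u)) i v) \<in> form_space scale (Suc d)"
    using prod assms(2) by (intro prod_in_forms) auto
  then show ?case by simp
next
  case zero
  show ?case by (simp add: forms_zero)
next
  case (add F G)
  then have "(\<lambda>v. F v * u v + G v * u v) \<in> form_space scale (Suc d)"
    by (rule forms_add)
  then show ?case by (simp add: algebra_simps)
next
  case (scale c F)
  then have "(\<lambda>v. c * (F v * u v)) \<in> form_space scale (Suc d)"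
    by (rule forms_cmult)
  then show ?case by (simp add: algebra_simps)
qed

lemma sum_prod_in_forms:
  fixes k d :: nat
  shows "(\<And>i j. i < k \<Longrightarrow> j < d \<Longrightarrow> w i j \<in> covec) \<Longrightarrow> (\<lambda>v. \<Sum>i<k. \<Prod>j<d. w i j v) \<in> form_space scale d"
proof (induction k)
  case 0
  show ?case by (simp add: forms_zero)
next
  case (Suc k)
  then have "(\<lambda>v. (\<Sum>i<k. \<Prod>j<d. w i j v) + (\<Prod>j<d. w k j v)) \<in> form_space scale d"
    by (intro forms_add prod_in_forms) auto
  then show ?case by simp
qed

lemma poly_family_prod:
  "\<forall>j<d. poly_family covec (X j) \<Longrightarrow> poly_family (form_space scale d) (\<lambda>x v. \<Prod>j<d. X j x v)"
proof (induction d)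
  case 0
  show ?case
    using poly_family_const[OF prod_in_forms[of 0 "\<lambda>_ _. 0"]] by simp
next
  case (Suc d)
  then have "poly_family (form_space scale (Suc d)) (\<lambda>x v. (\<Prod>j<d. X j x v) * X d x v)"
    by (intro poly_family_mult[where A = "form_space scale d" and B = covec] forms_mult_covec) auto
  then show ?case by simp
qed

text \<open>On a product of linear forms the substitution acts factor by factor, with
  \<open>w v + m x * w (\<pi> v)\<close> as new factors.\<close>

lemma poly_family_comp:
  assumes "R \<in> form_space scale d" "lin \<pi>" "mpoly m"
  shows "poly_family (form_space scale d) (\<lambda>x v. R (v + scale (m x) (\<pi> v)))"
  using assms(1)
proof (induction rule: forms_induct)
  case (prod w)
  have "poly_family covec (\<lambda>x v. w j v + m x * w j (\<pi> v))" if "j < d" for j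
  proof -
    have w: "w j \<in> covec" "(\<lambda>v. w j (\<pi> v)) \<in> covec"
      using that prod covec_comp[of "w j" \<pi>] assms(2) by auto
    show ?thesis
      by (intro poly_family_add poly_family_mult_mpoly poly_family_const w assms(3))
  qed
  then have "poly_family (form_space scale d) (\<lambda>x v. \<Prod>j<d. w j v + m x * w j (\<pi> v))"
    by (intro poly_family_prod) auto
  moreover have "(\<Prod>j<d. w j v + m x * w j (\<pi> v)) = (\<Prod>j<d. w j (v + scale (m x) (\<pi> v)))" for x v
    using prod by (intro prod.cong) (auto simp: covecD)
  ultimately show ?case by simp
next
  case zero
  show ?case by (rule poly_family.zero)
next
  case (add F G)
  then show ?case by (rule poly_family_add)
next
  case (scale c F)
  then show ?case by (rule poly_family_mult_mpoly) (rule mpoly_const)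
qed

end

section \<open>Degree bounds from highest weights\<close>

context complex_space
begin

text \<open>For a projection \<open>\<pi>\<close>, this multiplies its image by \<open>c\<close> and
  fixes its kernel.\<close>

definition stretch :: "('v \<Rightarrow> 'v) \<Rightarrow> complex \<Rightarrow> 'v \<Rightarrow> 'v" where
  "stretch \<pi> c v = v + scale (c - 1) (\<pi> v)"

lemma stretch_compose:
  assumes "lin \<pi>" "\<And>v. \<pi> (\<pi> v) = \<pi> v"
  shows "stretch \<pi> c (stretch \<pi> c' v) = stretch \<pi> (c * c') v"
proof -
  have "stretch \<pi> c (stretch \<pi> c' v) = v + (scale (c' - 1) (\<pi> v) + scale (c - 1) (\<pi> v) + scale ((c - 1) * (c' - 1)) (\<pi> v))"
    by (simp add: stretch_def linD[OF assms(1)] assms(2) scale_right_distrib add.assoc)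
  also have "\<dots> = v + scale (c' - 1 + (c - 1) + (c - 1) * (c' - 1)) (\<pi> v)"
    by (simp only: scale_left_distrib)
  also have "c' - 1 + (c - 1) + (c - 1) * (c' - 1) = c * c' - 1"
    by (simp add: algebra_simps)
  finally show ?thesis by (simp add: stretch_def)
qed

lemma lin_stretch:
  assumes "lin \<pi>"
  shows "lin (stretch \<pi> c)"
  by (rule linI) (simp_all add: stretch_def linD[OF assms] scale_right_distrib scale_left_commute)

lemma stretch_GL:
  assumes "lin \<pi>" "\<And>v. \<pi> (\<pi> v) = \<pi> v" "c \<noteq> 0"
  shows "stretch \<pi> c \<in> GL scale"
proof -
  have "stretch \<pi> 1 v = v" for v by (simp add: stretch_def)
  then show ?thesis
    unfolding GL_def using assms
    by (intro GL_I[of _ "stretch \<pi> (1 / c)"] lin_stretch) (simp_all add: stretch_compose)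
qed

lemma GL_compose: "g \<in> GL scale \<Longrightarrow> h \<in> GL scale \<Longrightarrow> g \<circ> h \<in> GL scale"
  unfolding GL_def by (auto intro!: linI bij_comp simp: linD)

end

locale highest_weight_vector = complex_space scale Basis
  for scale :: "complex \<Rightarrow> 'v::ab_group_add \<Rightarrow> 'v" and Basis :: "'v set" +
  fixes F :: "('v \<Rightarrow> complex) \<Rightarrow> complex" and n \<delta> d :: nat and b :: "nat \<Rightarrow> 'v" and lam :: "nat list"
  assumes basis: "ordered_basis scale n b"
    and F: "F \<in> sym_sym scale \<delta> d"
    and unipotent: "\<And>g. g \<in> GL scale \<Longrightarrow> (\<forall>j<n. g (b j) - b j \<in> span (b ` {..<j})) \<Longrightarrow> gl_action g F = F"
    and torus: "\<And>g t. g \<in> GL scale \<Longrightarrow> (\<forall>i<n. g (b i) = scale (t i) (b i)) \<Longrightarrow>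
      gl_action g F = fscale (\<Prod>i<n. t i ^ nth_default 0 lam i) F"
begin

section \<open>Dual coordinates, projections and the action of stretches\<close>

definition coord :: "nat \<Rightarrow> 'v \<Rightarrow> complex" where
  "coord k v = representation (b ` {..<n}) v (b k)"

lemma indep: "independent (b ` {..<n})" and span_b: "span (b ` {..<n}) = UNIV" and inj_b: "inj_on b {..<n}"
  using basis by (auto simp: ordered_basis_def)

lemma n_eq_dim: "n = dim (UNIV :: 'v set)"
proof -
  have "dim (UNIV :: 'v set) = card (b ` {..<n})"
    using indep span_b by (intro dim_eq_card) simp_all
  then show ?thesis by (simp add: card_image inj_b)
qed

lemma coord_covec: "coord k \<in> covec"
  by (rule covecI) (simp_all add: coord_def representation_add representation_scale indep span_b)

lemma coord_b: "i < n \<Longrightarrow> k < n \<Longrightarrow> coord k (b i) = (if k = i then 1 else 0)"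
  using inj_b by (auto simp: coord_def representation_basis indep inj_on_def)

lemma coord_sum:
  assumes "k < p" "p \<le> n"
  shows "coord k (\<Sum>i<p. scale (a i) (b i)) = a k"
proof -
  have "coord k (\<Sum>i<p. scale (a i) (b i)) = (\<Sum>i<p. a i * coord k (b i))"
    by (rule covec_sum[OF coord_covec])
  also have "\<dots> = (\<Sum>i<p. if i = k then a i else 0)"
    using assms by (intro sum.cong) (auto simp: coord_b)
  finally show ?thesis using assms by simp
qed

lemma span_expand:
  assumes "v \<in> span (b ` {..<p})" "p \<le> n"
  shows "(\<Sum>k<p. scale (coord k v) (b k)) = v"
  using assms(1)
proof (induction rule: span_induct_alt)
  case base
  have "coord k 0 = 0" for k
    by (simp add: coord_def representation_zero)
  then show ?case by simp
next
  case (step c x y)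
  then obtain i where i: "i < p" "x = b i" by auto
  have "(\<Sum>k<p. scale (coord k (scale c x + y)) (b k)) =
      (\<Sum>k<p. (if k = i then scale c (b k) else 0) + scale (coord k y) (b k))"
    using i assms(2) by (intro sum.cong) (auto simp: covecD[OF coord_covec] coord_b scale_left_distrib)
  then show ?case
    using i step by (simp add: sum.distrib)
qed

text \<open>A large multiple of \<open>coord k\<close> added to \<open>U k\<close> makes the forms
  independent on the span of the first \<open>p\<close> basis vectors. Then \<open>\<pi>\<close> is
  the projection onto this span along their common kernel, and it preserves the perturbed
  forms.\<close>

lemma exists_projection:
  assumes U: "\<forall>k<p. U k \<in> covec" and p: "p \<le> n"
  shows "\<exists>C. \<forall>\<epsilon>. cmod \<epsilon> > C \<longrightarrow> (\<exists>\<pi>. lin \<pi> \<and> (\<forall>v. \<pi> v \<in> span (b ` {..<p})) \<and>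
    (\<forall>i<p. \<pi> (b i) = b i) \<and> (\<forall>k<p. \<forall>v. U k (\<pi> v) + \<epsilon> * coord k (\<pi> v) = U k v + \<epsilon> * coord k v))"
proof -
  let ?C = "\<Sum>l<p. \<Sum>k<p. cmod (U l (b k))"
  have C: "?C \<ge> 0" by (intro sum_nonneg) auto
  have "\<exists>\<pi>. lin \<pi> \<and> (\<forall>v. \<pi> v \<in> span (b ` {..<p})) \<and> (\<forall>i<p. \<pi> (b i) = b i) \<and>
      (\<forall>k<p. \<forall>v. U k (\<pi> v) + \<epsilon> * coord k (\<pi> v) = U k v + \<epsilon> * coord k v)"
    if \<epsilon>: "cmod \<epsilon> > ?C" for \<epsilon>
  proof -
    have "\<epsilon> \<noteq> 0" using \<epsilon> C by auto
    \<comment> \<open>\<open>S\<close> collects all perturbed forms. It agrees on the span with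
      \<open>T'\<close>, an endomorphism of the whole space, for which injectivity implies
      surjectivity.\<close>
    define T where "T v = (\<Sum>k<p. scale (U k v) (b k))" for v
    define T' where "T' v = T v + scale \<epsilon> v" for v
    define S where "S v = (\<Sum>k<p. scale (U k v + \<epsilon> * coord k v) (b k))" for v
    have T_span: "T v \<in> span (b ` {..<p})" and S_span: "S v \<in> span (b ` {..<p})" for v
      unfolding T_def S_def by (intro span_sum span_scale span_base; simp)+
    have lin_T: "lin T"
      using U by (intro linI)
        (auto simp: T_def covecD scale_left_distrib sum.distrib scale_sum_right intro!: sum.cong)
    have lin_S: "lin S"
      using U by (intro linI)
        (auto simp: S_def covecD[OF coord_covec] covecD scale_left_distrib sum.distrib scale_sum_right
          distrib_left mult.left_commute scale_right_distrib intro!: sum.cong)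
    have lin_T': "lin T'"
      by (rule linI) (simp_all add: T'_def linD[OF lin_T] scale_right_distrib scale_left_commute)
    have S_T': "S v = T' v" if "v \<in> span (b ` {..<p})" for v
    proof -
      have "S v = T v + scale \<epsilon> (\<Sum>k<p. scale (coord k v) (b k))"
        by (simp add: S_def T_def scale_left_distrib sum.distrib scale_sum_right)
      then show ?thesis using span_expand[OF that p] by (simp add: T'_def)
    qed
    \<comment> \<open>A kernel vector lies in the span and satisfies
      \<open>\<epsilon> * coord l v = - U l v\<close>; summing absolute values over \<open>l\<close>
      forces its coordinates to vanish, as \<open>\<epsilon>\<close> is large.\<close>
    have ker: "v = 0" if "T' v = 0" for v
    proof -
      have "v = scale (- 1 / \<epsilon>) (T v)"
      proof -
        have "T v = - scale \<epsilon> v"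
          using that by (simp add: T'_def eq_neg_iff_add_eq_0)
        then show ?thesis using \<open>\<epsilon> \<noteq> 0\<close> by simp
      qed
      then have v: "v \<in> span (b ` {..<p})"
        using span_scale[OF T_span[of v], of "- 1 / \<epsilon>"] by simp
      let ?s = "\<Sum>k<p. cmod (coord k v)"
      have s: "?s \<ge> 0" by (intro sum_nonneg) auto
      have "cmod \<epsilon> * cmod (coord l v) \<le> ?s * (\<Sum>k<p. cmod (U l (b k)))" if "l < p" for l
      proof -
        have "0 = coord l (S v)"
          using \<open>T' v = 0\<close> S_T'[OF v] covecD(2)[OF coord_covec, of l 0 0] by simp
        also have "coord l (S v) = U l v + \<epsilon> * coord l v"
          unfolding S_def by (rule coord_sum[OF that p])
        finally have "\<epsilon> * coord l v = - U l v"
          by (simp add: eq_neg_iff_add_eq_0 add.commute)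
        then have "cmod \<epsilon> * cmod (coord l v) = cmod (U l v)"
          by (metis norm_minus_cancel norm_mult)
        also have "U l v = U l (\<Sum>k<p. scale (coord k v) (b k))"
          by (simp add: span_expand[OF v p])
        also have "\<dots> = (\<Sum>k<p. coord k v * U l (b k))"
          using U that by (intro covec_sum) simp
        also have "cmod \<dots> \<le> (\<Sum>k<p. cmod (coord k v) * cmod (U l (b k)))"
          by (rule order_trans[OF norm_sum]) (simp add: norm_mult)
        also have "\<dots> \<le> (\<Sum>k<p. ?s * cmod (U l (b k)))"
          by (intro sum_mono mult_right_mono member_le_sum) auto
        finally show ?thesis by (simp add: sum_distrib_left)
      qed
      then have "(\<Sum>l<p. cmod \<epsilon> * cmod (coord l v)) \<le> (\<Sum>l<p. ?s * (\<Sum>k<p. cmod (U l (b k))))"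
        by (intro sum_mono) auto
      then have "(cmod \<epsilon> - ?C) * ?s \<le> 0"
        by (simp only: sum_distrib_left[symmetric]) (simp add: algebra_simps)
      then have "?s = 0"
        using s \<epsilon> by (simp add: mult_le_0_iff)
      then have "\<forall>k<p. coord k v = 0"
        by (subst (asm) sum_nonneg_eq_0_iff) auto
      then show ?thesis
        using span_expand[OF v p] by simp
    qed
    have inj: "v = w" if "T' v = T' w" for v w
    proof -
      have "T' (v - w) = T' v + T' (scale (- 1) w)"
        using linD(1)[OF lin_T', of v "scale (- 1) w"] by simp
      also have "\<dots> = 0"
        using that by (simp only: linD[OF lin_T']) simp
      finally show ?thesis using ker by fastforce
    qed
    then have "surj T'"
      by (intro linear_inj_imp_surj lin_T') (simp add: inj_def)
    \<comment> \<open>As \<open>S = T'\<close> on the span, this is the identity there, and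
      \<open>S (\<pi> v) = S v\<close> everywhere.\<close>
    define \<pi> where "\<pi> v = inv T' (S v)" for v
    have T'_pi: "T' (\<pi> v) = S v" for v
      unfolding \<pi>_def by (rule surj_f_inv_f[OF \<open>surj T'\<close>])
    have pi_span: "\<pi> v \<in> span (b ` {..<p})" for v
    proof -
      have "scale \<epsilon> (\<pi> v) = S v - T (\<pi> v)"
        using T'_pi[of v] by (simp add: T'_def algebra_simps)
      then have "scale (1 / \<epsilon>) (S v - T (\<pi> v)) = \<pi> v"
        using \<open>\<epsilon> \<noteq> 0\<close> by (metis nonzero_divide_eq_eq scale_one scale_scale)
      then show ?thesis
        by (metis span_scale span_diff S_span T_span)
    qed
    have "lin \<pi>"
      by (rule linI; rule inj) (simp_all add: linD[OF lin_T'] T'_pi linD[OF lin_S])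
    moreover have "\<pi> (b i) = b i" if "i < p" for i
      by (rule inj) (use that in \<open>simp add: T'_pi S_T' span_base\<close>)
    moreover have "U k (\<pi> v) + \<epsilon> * coord k (\<pi> v) = U k v + \<epsilon> * coord k v" if "k < p" for k v
    proof -
      have "coord k (S (\<pi> v)) = coord k (S v)"
        by (simp add: S_T'[OF pi_span] T'_pi)
      then show ?thesis
        unfolding S_def coord_sum[OF that p] .
    qed
    ultimately show ?thesis using pi_span by blast
  qed
  then show ?thesis by blast
qed

lemma projection_idem:
  assumes "lin \<pi>" "\<And>v. \<pi> v \<in> span (b ` {..<p})" "\<And>i. i < p \<Longrightarrow> \<pi> (b i) = b i" "p \<le> n"
  shows "\<pi> (\<pi> v) = \<pi> v"
proof -
  have "\<pi> (\<Sum>k\<in>K. scale (a k) (b k)) = (\<Sum>k\<in>K. scale (a k) (b k))" if "K \<subseteq> {..<p}" for a K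
  proof -
    have "\<pi> 0 = 0" using linD(2)[OF assms(1), of 0 0] by simp
    then show ?thesis
      using that by (induction K rule: infinite_finite_induct) (simp_all add: linD[OF assms(1)] assms(3))
  qed
  from this[of "{..<p}" "\<lambda>k. coord k (\<pi> v)"] show ?thesis
    by (simp add: span_expand[OF assms(2,4)])
qed

text \<open>The stretches of \<open>\<pi>\<close> and of the coordinate projection onto the same
  span differ by a unipotent element, which fixes \<open>F\<close>. The second stretch is the torus
  element with \<open>p\<close> entries \<open>c\<close> followed by ones.\<close>

lemma stretch_action:
  assumes "lin \<pi>" "\<And>v. \<pi> v \<in> span (b ` {..<p})" "\<And>i. i < p \<Longrightarrow> \<pi> (b i) = b i" "p \<le> n" "c \<noteq> 0"
  shows "F (\<lambda>v. P (stretch \<pi> c v)) = c ^ (\<Sum>i<p. nth_default 0 lam i) * F P"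
proof -
  let ?\<sigma> = "\<lambda>v. \<Sum>k<p. scale (coord k v) (b k)"
  note idem = projection_idem[OF assms(1-4)]
  have lin_\<sigma>: "lin ?\<sigma>"
    by (rule linI) (simp_all add: covecD[OF coord_covec] scale_left_distrib sum.distrib scale_sum_right)
  have \<sigma>_span: "?\<sigma> v \<in> span (b ` {..<p})" for v
    by (intro span_sum span_scale span_base) simp
  have idem_\<sigma>: "?\<sigma> (?\<sigma> v) = ?\<sigma> v" for v
    by (rule span_expand[OF \<sigma>_span assms(4)])
  have \<sigma>_b: "?\<sigma> (b i) = (if i < p then b i else 0)" if "i < n" for i
  proof -
    have "?\<sigma> (b i) = (\<Sum>k<p. if k = i then b k else 0)"
      using that assms(4) by (intro sum.cong) (auto simp: coord_b)
    then show ?thesis by simp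
  qed
  let ?t = "stretch ?\<sigma> c" and ?g = "stretch \<pi> c \<circ> stretch ?\<sigma> (1 / c)"
  have "?g \<in> GL scale"
    using assms by (intro GL_compose stretch_GL idem idem_\<sigma> lin_\<sigma>) auto
  moreover have "?g (b j) - b j \<in> span (b ` {..<j})" if "j < n" for j
  proof (cases "j < p")
    case True
    have "stretch ?\<sigma> (1 / c) (b j) = scale (1 / c) (b j)"
      using True that by (simp add: stretch_def \<sigma>_b scale_left_diff_distrib)
    moreover have "stretch \<pi> c (scale (1 / c) (b j)) = b j"
      using True assms(5) by (simp add: stretch_def linD[OF assms(1)] assms(3) scale_left_distrib[symmetric] diff_divide_distrib)
    ultimately show ?thesis by (simp add: span_zero)
  next
    case False
    then have "stretch ?\<sigma> (1 / c) (b j) = b j"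
      using that by (simp add: stretch_def \<sigma>_b)
    then have "?g (b j) - b j = scale (c - 1) (\<pi> (b j))"
      by (simp only: o_apply) (simp add: stretch_def)
    moreover have "\<pi> (b j) \<in> span (b ` {..<j})"
      using assms(2)[of "b j"] span_mono[OF image_mono, of "{..<p}" "{..<j}" b] False by auto
    ultimately show ?thesis by (simp add: span_scale)
  qed
  ultimately have g: "gl_action ?g F = F"
    by (intro unipotent) auto
  have "gl_action ?t F = fscale (\<Prod>i<n. (if i < p then c else 1) ^ nth_default 0 lam i) F"
  proof (rule torus)
    show "?t \<in> GL scale"
      using assms(5) by (intro stretch_GL idem_\<sigma> lin_\<sigma>)
    show "\<forall>i<n. ?t (b i) = scale (if i < p then c else 1) (b i)"
      by (auto simp: stretch_def \<sigma>_b scale_left_diff_distrib)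
  qed
  also have "(\<Prod>i<n. (if i < p then c else 1) ^ nth_default 0 lam i) = (\<Prod>i<p. c ^ nth_default 0 lam i)"
    using assms(4) by (intro prod.mono_neutral_cong_right) auto
  also have "\<dots> = c ^ (\<Sum>i<p. nth_default 0 lam i)"
    by (rule power_sum[symmetric])
  finally have t: "F (Q \<circ> ?t) = c ^ (\<Sum>i<p. nth_default 0 lam i) * F Q" for Q
    by (simp add: gl_action_def pw_scale_def fun_eq_iff)
  have "?g (?t v) = stretch \<pi> c v" for v
    using assms(5) by (simp add: stretch_compose[OF lin_\<sigma> idem_\<sigma>]) (simp add: stretch_def)
  then have eq: "(\<lambda>v. P (stretch \<pi> c v)) = (P \<circ> ?g) \<circ> ?t"
    by (simp add: fun_eq_iff)
  have "F (P \<circ> ?g) = F P"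
    using fun_cong[OF g, of P] unfolding gl_action_def .
  then show ?thesis
    unfolding eq t by (rule arg_cong)
qed

section \<open>Degree bounds along families of forms\<close>

definition weight_sum :: "nat \<Rightarrow> nat" where
  "weight_sum p = (\<Sum>i<p. nth_default 0 lam i)"

lemma mpoly_F:
  assumes "poly_family (form_space scale d) P"
  shows "mpoly (\<lambda>x. F (P x))"
  by (rule mpoly_sym_dual[OF F[unfolded sym_sym_def] subspace_forms assms])

text \<open>The stretch of \<open>\<pi>\<close> multiplies every \<open>U k\<close> by
  \<open>c\<close>. So the form at \<open>c\<close> is the stretch of a form polynomial in
  \<open>1 / c\<close>, its value is \<open>c ^ weight_sum p\<close> times a polynomial in
  \<open>1 / c\<close>, and \<open>degree_at_most_reciprocal\<close> applies.\<close>

lemma bound_of_projection: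
  assumes "lin \<pi>" "\<And>v. \<pi> v \<in> span (b ` {..<p})" "\<And>i. i < p \<Longrightarrow> \<pi> (b i) = b i" "p \<le> n"
    and U: "\<And>k. k < p \<Longrightarrow> U k \<in> covec" "\<And>k v. k < p \<Longrightarrow> U k (\<pi> v) = U k v"
    and Y: "\<And>j. j < d \<Longrightarrow> Y j \<in> covec" and R: "R \<in> form_space scale d"
  shows "degree_at_most (\<lambda>c. F (\<lambda>v. R v + \<gamma> * (\<Prod>j<d. Y j v + c * (\<Sum>k<p. s j k * U k v)))) (weight_sum p)"
proof -
  let ?W = "\<lambda>j v. \<Sum>k<p. s j k * U k v"
  have W: "poly_family covec (\<lambda>x. ?W j)" for j
    by (intro poly_family_sum allI impI poly_family_mult_mpoly[of _ _ "\<lambda>_. s j k" for k] poly_family_const U mpoly_const)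
  let ?P = "\<lambda>c v. R v + \<gamma> * (\<Prod>j<d. Y j v + c * ?W j v)"
  \<comment> \<open>\<open>R\<close> and the \<open>Y j\<close> are composed with the stretch by
    \<open>c\<close>, the \<open>U k\<close> are not; at \<open>1 / c\<close> this composition is
    undone by the stretch by \<open>c\<close>.\<close>
  let ?Q = "\<lambda>c v. R (v + scale (c - 1) (\<pi> v)) + \<gamma> * (\<Prod>j<d. (Y j v + (c - 1) * Y j (\<pi> v)) + ?W j v)"
  have m: "mpoly (\<lambda>x. x 0 0)" "mpoly (\<lambda>x. x 0 0 - 1)"
    using mpoly_var[of 0 0] mpoly_add[OF mpoly_var[of 0 0] mpoly_const[of "- 1"]] by simp_all
  have "poly_family (form_space scale d) (\<lambda>x. ?P (x 0 0))"
    by (intro poly_family_add poly_family_const R poly_family_mult_mpoly[of _ _ "\<lambda>_. \<gamma>"] mpoly_const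
        poly_family_prod allI impI Y poly_family_mult_mpoly[of _ _ "\<lambda>x. x 0 0"] W m)
  from mpoly_line[OF mpoly_F[OF this], of "\<lambda>_ _. 0" "\<lambda>_ _. 1"]
  obtain P where P: "\<forall>c. F (?P c) = poly P c" by auto
  have Y\<pi>: "(\<lambda>v. Y j (\<pi> v)) \<in> covec" if "j < d" for j
    using Y[OF that] assms(1) by (rule covec_comp)
  have "poly_family (form_space scale d) (\<lambda>x. ?Q (x 0 0))"
    by (intro poly_family_add poly_family_comp[where m = "\<lambda>x. x 0 0 - 1"] R assms(1) m
        poly_family_mult_mpoly[of _ _ "\<lambda>_. \<gamma>"] mpoly_const
        poly_family_prod allI impI poly_family_const Y poly_family_mult_mpoly[of _ _ "\<lambda>x. x 0 0 - 1"] Y\<pi> W)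
  from mpoly_line[OF mpoly_F[OF this], of "\<lambda>_ _. 0" "\<lambda>_ _. 1"]
  obtain Q where Q: "\<forall>c. F (?Q c) = poly Q c" by auto
  have "poly P c = c ^ weight_sum p * poly Q (1 / c)" if c: "c \<noteq> 0" for c
  proof -
    have inv: "stretch \<pi> (1 / c) (stretch \<pi> c v) = v" for v
      using c by (simp add: stretch_compose[OF assms(1) projection_idem[OF assms(1-4)]]) (simp add: stretch_def)
    have "?Q (1 / c) (stretch \<pi> c v) = ?P c v" for v
    proof -
      let ?v = "stretch \<pi> c v"
      have "U k ?v = c * U k v" if "k < p" for k
        using that by (simp add: stretch_def covecD[OF U(1)] U(2) left_diff_distrib)
      then have "?W j ?v = c * ?W j v" for j
        by (simp add: sum_distrib_left mult.left_commute)
      moreover have "Y j ?v + (1 / c - 1) * Y j (\<pi> ?v) = Y j v" if "j < d" for j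
        using arg_cong[OF inv[of v], of "Y j"] by (simp add: stretch_def[of _ "1 / c"] covecD[OF Y[OF that]])
      moreover have "R (?v + scale (1 / c - 1) (\<pi> ?v)) = R v"
        using arg_cong[OF inv[of v], of R] by (simp add: stretch_def[of _ "1 / c"])
      ultimately show ?thesis by simp
    qed
    then have "F (?P c) = F (\<lambda>v. ?Q (1 / c) (stretch \<pi> c v))"
      by simp
    also have "\<dots> = c ^ weight_sum p * F (?Q (1 / c))"
      unfolding weight_sum_def by (rule stretch_action[OF assms(1-4) c])
    finally show ?thesis
      using P Q by simp
  qed
  then have "degree P \<le> weight_sum p"
    by (rule degree_at_most_reciprocal)
  then show ?thesis
    using P by (intro degree_at_mostI[of P]) auto
qed

text \<open>For large \<open>\<epsilon>\<close> the forms \<open>U k + \<epsilon> * coord k\<close>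
  are preserved by a projection. The values are polynomial in \<open>\<epsilon>\<close>, so the
  bound persists at \<open>\<epsilon> = 0\<close>.\<close>

lemma weight_bound:
  assumes p: "p \<le> n" and U: "\<And>k. k < p \<Longrightarrow> U k \<in> covec"
    and Y: "\<And>j. j < d \<Longrightarrow> Y j \<in> covec" and R: "R \<in> form_space scale d"
  shows "degree_at_most (\<lambda>c. F (\<lambda>v. R v + \<gamma> * (\<Prod>j<d. Y j v + c * (\<Sum>k<p. s j k * U k v)))) (weight_sum p)"
proof -
  let ?P = "\<lambda>\<epsilon> c v. R v + \<gamma> * (\<Prod>j<d. Y j v + c * (\<Sum>k<p. s j k * (U k v + \<epsilon> * coord k v)))"
  have "poly_family (form_space scale d) (\<lambda>x. ?P (x 0 1) (x 0 0))"
    by (intro poly_family_add poly_family_const R poly_family_mult_mpoly[of _ _ "\<lambda>_. \<gamma>"] mpoly_const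
        poly_family_prod allI impI Y poly_family_mult_mpoly[of _ _ "\<lambda>x. x 0 0"] poly_family_sum
        poly_family_mult_mpoly[of _ _ "\<lambda>_. s j k" for j k] U poly_family_mult_mpoly[of _ _ "\<lambda>x. x 0 1"] coord_covec
        mpoly_var)
  from mpoly_plane[OF mpoly_F[OF this], of "\<lambda>_ _. 0" "\<lambda>_ l. if l = 1 then 1 else 0" "\<lambda>_ l. if l = 0 then 1 else 0"]
  obtain P where P: "\<forall>\<epsilon> c. F (?P \<epsilon> c) = poly (poly P [:c:]) \<epsilon>" by auto
  obtain C where C: "\<forall>\<epsilon>. cmod \<epsilon> > C \<longrightarrow> (\<exists>\<pi>. lin \<pi> \<and> (\<forall>v. \<pi> v \<in> span (b ` {..<p})) \<and>
      (\<forall>i<p. \<pi> (b i) = b i) \<and> (\<forall>k<p. \<forall>v. U k (\<pi> v) + \<epsilon> * coord k (\<pi> v) = U k v + \<epsilon> * coord k v))"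
    using exists_projection[of p U] U p by blast
  have "degree_at_most (\<lambda>c. poly (poly P [:c:]) \<epsilon>) (weight_sum p)" if \<epsilon>: "\<epsilon> \<in> {\<epsilon>. cmod \<epsilon> > C}" for \<epsilon>
  proof -
    obtain \<pi> where \<pi>: "lin \<pi>" "\<forall>v. \<pi> v \<in> span (b ` {..<p})" "\<forall>i<p. \<pi> (b i) = b i"
      "\<forall>k<p. \<forall>v. U k (\<pi> v) + \<epsilon> * coord k (\<pi> v) = U k v + \<epsilon> * coord k v"
      using C \<epsilon> by blast
    have "(\<lambda>v. U k v + \<epsilon> * coord k v) \<in> covec" if "k < p" for k
      by (rule covecI) (simp_all add: covecD[OF U[OF that]] covecD[OF coord_covec] algebra_simps)
    then have "degree_at_most (\<lambda>c. F (?P \<epsilon> c)) (weight_sum p)"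
      using \<pi> p Y R by (intro bound_of_projection[of \<pi>]) auto
    then show ?thesis using P by simp
  qed
  from degree_at_most_dense[OF infinite_cmod_gt[of C] this, where s = 0]
  have "degree_at_most (\<lambda>c. F (?P 0 c)) (weight_sum p)"
    by (simp only: P)
  then show ?thesis by simp
qed

lemma F_outside: "P \<notin> form_space scale d \<Longrightarrow> F P = 0"
  using F unfolding sym_sym_def by (induction rule: sym_dual_induct) auto

lemma F_homogeneous: "P \<in> form_space scale d \<Longrightarrow> F (\<lambda>v. c * P v) = c ^ \<delta> * F P"
  using sym_dual_homogeneous[OF F[unfolded sym_sym_def] subspace_forms] by (simp add: pw_scale_def)

text \<open>The scalar 2 acts on \<open>F\<close> both through homogeneity, by
  \<open>(2 ^ d) ^ \<delta>\<close>, and as a torus element, by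
  \<open>2 ^ weight_sum n\<close>.\<close>

lemma weight_sum_total:
  assumes "F \<noteq> (\<lambda>_. 0)"
  shows "weight_sum n = d * \<delta>"
proof -
  obtain P where P: "F P \<noteq> 0" using assms by blast
  then have form: "P \<in> form_space scale d" using F_outside by blast
  have "F (\<lambda>v. P (stretch (\<lambda>v. v) 2 v)) = 2 ^ weight_sum n * F P"
    unfolding weight_sum_def by (rule stretch_action) (auto intro: linI simp: span_b)
  moreover have "P (stretch (\<lambda>v. v) 2 v) = 2 ^ d * P v" for v
    using form
  proof (induction rule: forms_induct)
    case (prod w)
    have "(\<Prod>i<d. w i (stretch (\<lambda>v. v) 2 v)) = (\<Prod>i<d. 2 * w i v)"
      using prod by (intro prod.cong) (auto simp: stretch_def covecD)
    then show ?case by (simp add: prod.distrib)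
  qed (simp_all add: algebra_simps)
  ultimately have "(2 ^ d) ^ \<delta> * F P = 2 ^ weight_sum n * F P"
    using F_homogeneous[OF form, of "2 ^ d"] by simp
  then have "(2 :: complex) ^ (d * \<delta>) = 2 ^ weight_sum n"
    using P by (simp add: power_mult)
  then have "of_nat (2 ^ (d * \<delta>)) = (of_nat (2 ^ weight_sum n) :: complex)"
    by simp
  then have "(2 :: nat) ^ (d * \<delta>) = 2 ^ weight_sum n"
    unfolding of_nat_eq_iff .
  then show ?thesis by simp
qed

end

locale chow_weight = highest_weight_vector scale Basis F n \<delta> q b lam
  for scale :: "complex \<Rightarrow> 'v::ab_group_add \<Rightarrow> 'v" and Basis :: "'v set"
    and F :: "('v \<Rightarrow> complex) \<Rightarrow> complex" and n \<delta> q :: nat and b :: "nat \<Rightarrow> 'v" and lam :: "nat list" +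
  assumes q: "even q" "2 \<le> q" "q \<le> n"
    and weight_1: "weight_sum 1 \<le> q + 2"
    and weight_q: "weight_sum (q - 1) < (q - 1) * (q + 2)"

text \<open>A matrix will encode \<open>q\<close> combinations of the forms \<open>x l\<close>, one
  in each row, so that row operations act on the factors of a product.\<close>

locale chow_fibre = chow_weight scale Basis F n \<delta> q b lam
  for scale :: "complex \<Rightarrow> 'v::ab_group_add \<Rightarrow> 'v" and Basis :: "'v set"
    and F :: "('v \<Rightarrow> complex) \<Rightarrow> complex" and n \<delta> q :: nat and b :: "nat \<Rightarrow> 'v" and lam :: "nat list" +
  fixes x :: "nat \<Rightarrow> 'v \<Rightarrow> complex" and R :: "'v \<Rightarrow> complex"
  assumes x: "\<And>l. l < q \<Longrightarrow> x l \<in> covec" and R: "R \<in> form_space scale q"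
begin

definition val :: "cmat \<Rightarrow> complex \<Rightarrow> complex" where
  "val W \<gamma> = F (\<lambda>v. R v + \<gamma> * (\<Prod>j<q. \<Sum>l<q. W j l * x l v))"

definition val_poly :: "cmat \<Rightarrow> complex poly" where
  "val_poly = (SOME p. (\<forall>W \<gamma>. val W \<gamma> = poly (p W) \<gamma>) \<and> (\<forall>k. mpoly (\<lambda>W. coeff (p W) k)))"

text \<open>The entry \<open>(q, 0)\<close>, which \<open>val\<close> does not use, serves as the variable \<open>\<gamma>\<close>.\<close>

lemma mpoly_val: "mpoly (\<lambda>W. val W (W q 0))"
proof -
  have "poly_family (form_space scale q) (\<lambda>W v. R v + W q 0 * (\<Prod>j<q. \<Sum>l<q. W j l * x l v))"
    by (intro poly_family_add poly_family_const R poly_family_mult_mpoly[of _ _ "\<lambda>W. W q 0"] mpoly_var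
        poly_family_prod allI impI poly_family_sum poly_family_mult_mpoly[of _ _ "\<lambda>W. W j l" for j l] x)
  then show ?thesis
    unfolding val_def by (rule mpoly_F)
qed

lemma val_cong:
  assumes "\<And>j l. j < q \<Longrightarrow> l < q \<Longrightarrow> W j l = W' j l"
  shows "val W = val W'"
proof -
  have "(\<Prod>j<q. \<Sum>l<q. W j l * x l v) = (\<Prod>j<q. \<Sum>l<q. W' j l * x l v)" for v
    by (intro prod.cong sum.cong refl) (simp add: assms)
  then show ?thesis unfolding val_def by (simp only:)
qed

lemma val_poly: "val W \<gamma> = poly (val_poly W) \<gamma>" and mpoly_coeff_val: "mpoly (\<lambda>W. coeff (val_poly W) k)"
proof -
  obtain p where p: "\<forall>W \<gamma>. val (W(q := (W q)(0 := \<gamma>))) ((W(q := (W q)(0 := \<gamma>))) q 0) = poly (p W) \<gamma>"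
    "\<forall>k. mpoly (\<lambda>W. coeff (p W) k)"
    using mpoly_coeff[OF mpoly_val, of q 0] by blast
  \<comment> \<open>\<open>val\<close> ignores row \<open>q\<close>, so the auxiliary entry
    disappears from its matrix argument.\<close>
  have "val (W(q := (W q)(0 := \<gamma>))) = val W" for W \<gamma>
    by (rule val_cong) auto
  then have "(\<forall>W \<gamma>. val W \<gamma> = poly (p W) \<gamma>) \<and> (\<forall>k. mpoly (\<lambda>W. coeff (p W) k))"
    using p by simp
  then have ex: "\<exists>p. (\<forall>W \<gamma>. val W \<gamma> = poly (p W) \<gamma>) \<and> (\<forall>k. mpoly (\<lambda>W. coeff (p W) k))"
    by (rule exI[of _ p])
  have *: "(\<forall>W \<gamma>. val W \<gamma> = poly (val_poly W) \<gamma>) \<and> (\<forall>k. mpoly (\<lambda>W. coeff (val_poly W) k))"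
    unfolding val_poly_def by (rule someI_ex[OF ex])
  show "val W \<gamma> = poly (val_poly W) \<gamma>" "mpoly (\<lambda>W. coeff (val_poly W) k)"
    using * by blast+
qed

lemma val_poly_eqI: "(\<And>\<gamma>. val W \<gamma> = poly P \<gamma>) \<Longrightarrow> val_poly W = P"
  by (intro poly_eq_if_eq_nonzero) (simp add: val_poly[symmetric])

lemma coeff_bound:
  assumes "\<And>\<gamma>. degree_at_most (\<lambda>c. val (\<lambda>j l. y j l + c * z j l) \<gamma>) N"
  shows "degree_at_most (\<lambda>c. coeff (val_poly (\<lambda>j l. y j l + c * z j l)) a) N"
proof -
  \<comment> \<open>Row \<open>q\<close> is cleared so that the auxiliary entry
    \<open>(q, 0)\<close> is exactly \<open>t\<close>.\<close>
  let ?y = "\<lambda>j l. if j = q then 0 else y j l" and ?z = "\<lambda>j l. if j = q then 0 else z j l"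
    and ?w = "\<lambda>j l :: nat. if j = q \<and> l = 0 then 1 else 0 :: complex"
  obtain P where P: "\<forall>s t. val (\<lambda>j l. ?y j l + s * ?z j l + t * ?w j l) (?y q 0 + s * ?z q 0 + t * ?w q 0)
      = poly (poly P [:t:]) s"
    using mpoly_plane[OF mpoly_val, of ?y ?z ?w] ..
  have "val (\<lambda>j l. ?y j l + s * ?z j l + t * ?w j l) = val (\<lambda>j l. y j l + s * z j l)" for s t
    by (rule val_cong) auto
  then have P': "val (\<lambda>j l. y j l + s * z j l) t = poly (poly P [:t:]) s" for s t
    using P[rule_format, of s t] by simp
  show ?thesis
  proof (rule degree_at_mostI)
    show "degree (coeff P a) \<le> N"
      using assms by (intro degree_coeff_le) (simp add: P')
    fix s
    have "val_poly (\<lambda>j l. y j l + s * z j l) = map_poly (\<lambda>a. poly a s) P"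
      by (rule val_poly_eqI) (simp only: P' poly_poly_const)
    then show "coeff (val_poly (\<lambda>j l. y j l + s * z j l)) a = poly (coeff P a) s"
      by (simp add: coeff_map_poly)
  qed
qed

text \<open>\<open>weight_bound\<close> in terms of matrices: the vectors \<open>u k\<close> are the
  coefficients of the forms \<open>U k\<close>.\<close>

lemma row_bound:
  assumes "p \<le> n"
  shows "degree_at_most (\<lambda>c. coeff (val_poly (\<lambda>j l. y j l + c * (\<Sum>k<p. s j k * u k l))) a) (weight_sum p)"
proof (rule coeff_bound)
  fix \<gamma>
  let ?Y = "\<lambda>j v. \<Sum>l<q. y j l * x l v" and ?U = "\<lambda>k v. \<Sum>l<q. u k l * x l v"
  have lincomb: "(\<lambda>v. \<Sum>l<q. a l * x l v) \<in> covec" for a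
    by (rule covecI) (simp_all add: covecD[OF x] distrib_left sum.distrib sum_distrib_left mult.left_commute)
  have "degree_at_most (\<lambda>c. F (\<lambda>v. R v + \<gamma> * (\<Prod>j<q. ?Y j v + c * (\<Sum>k<p. s j k * ?U k v)))) (weight_sum p)"
    by (rule weight_bound[OF assms]) (use R lincomb in blast)+
  moreover have "(\<Sum>l<q. (y j l + c * (\<Sum>k<p. s j k * u k l)) * x l v) = ?Y j v + c * (\<Sum>k<p. s j k * ?U k v)" for j c v
  proof -
    have "(\<Sum>l<q. \<Sum>k<p. c * (s j k * (u k l * x l v))) = (\<Sum>k<p. \<Sum>l<q. c * (s j k * (u k l * x l v)))"
      by (rule sum.swap)
    then show ?thesis
      by (simp add: distrib_right sum.distrib sum_distrib_left sum_distrib_right mult.assoc)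
  qed
  ultimately show "degree_at_most (\<lambda>c. val (\<lambda>j l. y j l + c * (\<Sum>k<p. s j k * u k l)) \<gamma>) (weight_sum p)"
    by (simp only: val_def)
qed

section \<open>Symmetry, homogeneity and vanishing of the coefficients\<close>

lemma val_poly_swaprow:
  assumes "i < q" "j < q"
  shows "val_poly (swaprow i j W) = val_poly W"
proof (rule val_poly_eqI)
  fix \<gamma>
  let ?\<tau> = "\<lambda>a. if a = i then j else if a = j then i else a"
  have "(\<Prod>a<q. \<Sum>l<q. swaprow i j W a l * x l v) = (\<Prod>a<q. \<Sum>l<q. W a l * x l v)" for v
    by (rule prod.reindex_bij_witness[of _ ?\<tau> ?\<tau>]) (use assms in \<open>auto simp: swaprow_def\<close>)
  then show "val (swaprow i j W) \<gamma> = poly (val_poly W) \<gamma>"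
    by (simp add: val_poly[symmetric] val_def)
qed

lemma coeff_val_scale:
  assumes "\<And>v. (\<Prod>a<q. \<Sum>l<q. W' a l * x l v) = c * (\<Prod>a<q. \<Sum>l<q. W a l * x l v)"
  shows "coeff (val_poly W') k = c ^ k * coeff (val_poly W) k"
proof -
  have "val_poly W' = pcompose (val_poly W) [:0, c:]"
  proof (rule val_poly_eqI)
    fix \<gamma>
    have "val W' \<gamma> = val W (c * \<gamma>)"
      by (simp add: val_def assms mult.assoc mult.left_commute)
    then show "val W' \<gamma> = poly (pcompose (val_poly W) [:0, c:]) \<gamma>"
      by (simp add: val_poly poly_pcompose mult.commute)
  qed
  then show ?thesis by (simp add: coeff_pcompose_linear)
qed

lemma coeff_val_scalerow:
  assumes "i < q"
  shows "coeff (val_poly (scalerow i c W)) k = c ^ k * coeff (val_poly W) k"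
proof (rule coeff_val_scale)
  fix v
  have "(\<Prod>a<q. \<Sum>l<q. scalerow i c W a l * x l v) = (\<Prod>a<q. (if a = i then c else 1) * (\<Sum>l<q. W a l * x l v))"
    by (intro prod.cong) (auto simp: scalerow_def sum_distrib_left mult.assoc)
  also have "\<dots> = c * (\<Prod>a<q. \<Sum>l<q. W a l * x l v)"
    using assms by (simp add: prod.distrib)
  finally show "(\<Prod>a<q. \<Sum>l<q. scalerow i c W a l * x l v) = c * (\<Prod>a<q. \<Sum>l<q. W a l * x l v)" .
qed

text \<open>Scaling the first \<open>q - 1\<close> rows by \<open>c\<close> gives the factor
  \<open>c ^ ((q - 1) * k)\<close>, whose exponent exceeds the weight bound for \<open>q - 1\<close>
  forms.\<close>

lemma coeff_val_large:
  assumes "k \<ge> q + 2"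
  shows "coeff (val_poly W) k = 0"
proof (rule degree_at_most_monom_eq_0)
  let ?y = "\<lambda>j l. if j < q - 1 then 0 else W j l" and ?s = "\<lambda>j k. if j = k then 1 else 0"
  let ?W = "\<lambda>c j l. ?y j l + c * (\<Sum>k<q - 1. ?s j k * W k l)"
  show "degree_at_most (\<lambda>c. coeff (val_poly (?W c)) k) (weight_sum (q - 1))"
    using q by (intro row_bound) auto
  show "coeff (val_poly (?W c)) k = c ^ ((q - 1) * k) * coeff (val_poly W) k" for c
  proof -
    have W: "?W c j l = (if j < q - 1 then c else 1) * W j l" for j l
    proof -
      have "(\<Sum>k<q - 1. ?s j k * W k l) = (\<Sum>k<q - 1. if k = j then W j l else 0)"
        by (intro sum.cong) auto
      then show ?thesis by simp
    qed
    have "(\<Prod>a<q. \<Sum>l<q. ?W c a l * x l v) = c ^ (q - 1) * (\<Prod>a<q. \<Sum>l<q. W a l * x l v)" for v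
    proof -
      have "(\<Prod>a<q. \<Sum>l<q. ?W c a l * x l v) = (\<Prod>a<q. (if a < q - 1 then c else 1) * (\<Sum>l<q. W a l * x l v))"
        unfolding W by (simp add: sum_distrib_left mult.assoc)
      also have "\<dots> = (\<Prod>a<q. if a < q - 1 then c else 1) * (\<Prod>a<q. \<Sum>l<q. W a l * x l v)"
        by (rule prod.distrib)
      also have "(\<Prod>a<q. if a < q - 1 then c else 1) = (\<Prod>a<q - 1. c)"
        by (intro prod.mono_neutral_cong_right) auto
      finally show ?thesis by simp
    qed
    then have "coeff (val_poly (?W c)) k = (c ^ (q - 1)) ^ k * coeff (val_poly W) k"
      by (rule coeff_val_scale)
    then show ?thesis by (simp only: power_mult)
  qed
  show "weight_sum (q - 1) < (q - 1) * k"
    using weight_q assms by (meson less_le_trans mult_le_mono2)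
qed

text \<open>As \<open>q\<close> is even, the exponent \<open>q + 1\<close> is odd, and the weight
  bounds are those of \<open>symmetric_rows\<close> for it.\<close>

lemma coeff_val_middle: "coeff (val_poly W) (q + 1) = 0"
proof -
  interpret symmetric_rows "\<lambda>W. coeff (val_poly W) (q + 1)" q "q + 1"
  proof
    show "mpoly (\<lambda>W. coeff (val_poly W) (q + 1))" by (rule mpoly_coeff_val)
    show "odd (q + 1)" "2 \<le> q" using q by simp_all
    show "coeff (val_poly (swaprow i j W)) (q + 1) = coeff (val_poly W) (q + 1)" if "i < q" "j < q" for i j W
      using that by (simp add: val_poly_swaprow)
    show "coeff (val_poly (scalerow i c W)) (q + 1) = c ^ (q + 1) * coeff (val_poly W) (q + 1)" if "i < q" for i c W
      using that by (rule coeff_val_scalerow)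
    show "degree_at_most (\<lambda>c. coeff (val_poly (\<lambda>j l. y j l + c * (s j * u l))) (q + 1)) (q + 1 + 1)" for y s u
    proof -
      have "degree_at_most (\<lambda>c. coeff (val_poly (\<lambda>j l. y j l + c * (\<Sum>k<(1::nat). s j * u l))) (q + 1)) (weight_sum 1)"
        by (rule row_bound[where s = "\<lambda>j k. s j" and u = "\<lambda>k. u"]) (use q in simp)
      moreover have "(\<Sum>k<(1::nat). s j * u l) = s j * u l" for j l
        by simp
      ultimately have "degree_at_most (\<lambda>c. coeff (val_poly (\<lambda>j l. y j l + c * (s j * u l))) (q + 1)) (weight_sum 1)"
        by (simp only:)
      then show ?thesis
        by (rule degree_at_most_mono) (use weight_1 in simp)
    qed
    show "degree_at_most (\<lambda>c. coeff (val_poly (\<lambda>j l. y j l + c * (\<Sum>k<q - 1. z j k * w k l))) (q + 1))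
        ((q - 1) * (q + 1 + 1) - 1)" for y z w
    proof -
      have "degree_at_most (\<lambda>c. coeff (val_poly (\<lambda>j l. y j l + c * (\<Sum>k<q - 1. z j k * w k l))) (q + 1)) (weight_sum (q - 1))"
        using q by (intro row_bound) auto
      moreover have "weight_sum (q - 1) \<le> (q - 1) * (q + 1 + 1) - 1"
        using weight_q by simp
      ultimately show ?thesis
        by (rule degree_at_most_mono)
    qed
  qed
  show ?thesis using eq_0 by (rule fun_cong)
qed

lemma fibre_degree: "degree_at_most (\<lambda>\<gamma>. F (\<lambda>v. R v + \<gamma> * (\<Prod>j<q. x j v))) q"
proof (rule degree_at_mostI)
  \<comment> \<open>The identity matrix returns the forms \<open>x j\<close> themselves.\<close>
  let ?I = "\<lambda>j l. if j = l then 1 else 0"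
  have "coeff (val_poly ?I) k = 0" if "k > q" for k
    using coeff_val_large[of k ?I] coeff_val_middle[of ?I] that by (cases "k = q + 1") auto
  then show "degree (val_poly ?I) \<le> q"
    by (intro degree_le) auto
  fix \<gamma>
  have "(\<Sum>l<q. ?I j l * x l v) = x j v" if "j < q" for j v
  proof -
    have "(\<Sum>l<q. ?I j l * x l v) = (\<Sum>l<q. if l = j then x j v else 0)"
      by (intro sum.cong) auto
    then show ?thesis using that by simp
  qed
  then have "F (\<lambda>v. R v + \<gamma> * (\<Prod>j<q. x j v)) = val ?I \<gamma>"
    by (simp add: val_def)
  then show "F (\<lambda>v. R v + \<gamma> * (\<Prod>j<q. x j v)) = poly (val_poly ?I) \<gamma>"
    by (simp add: val_poly)
qed

end

section \<open>Sums of products of linear forms\<close>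

context chow_weight
begin

text \<open>One product is added at a time. With separate parameters for the old sum and the new
  product, the induction hypothesis bounds one degree and \<open>fibre_degree\<close> the other;
  equating the parameters adds the bounds.\<close>

lemma sum_degree:
  assumes "\<And>i j. i < k \<Longrightarrow> j < q \<Longrightarrow> w i j \<in> covec" "R \<in> form_space scale q"
  shows "degree_at_most (\<lambda>\<tau>. F (\<lambda>v. R v + \<tau> * (\<Sum>i<k. \<Prod>j<q. w i j v))) (q * k)"
  using assms
proof (induction k arbitrary: R)
  case 0
  show ?case
    by (rule degree_at_mostI[of "[:F R:]"]) simp_all
next
  case (Suc k)
  let ?Z = "\<lambda>v. \<Sum>i<k. \<Prod>j<q. w i j v" and ?z = "\<lambda>v. \<Prod>j<q. w k j v"
  have z: "?z \<in> form_space scale q" and Z: "?Z \<in> form_space scale q"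
    using Suc.prems by (auto intro!: prod_in_forms sum_prod_in_forms)
  have "poly_family (form_space scale q) (\<lambda>x v. (R v + x 0 1 * ?z v) + x 0 0 * ?Z v)"
    by (intro poly_family_add poly_family_const Suc.prems poly_family_mult_mpoly[of _ _ "\<lambda>x. x 0 0"]
        poly_family_mult_mpoly[of _ _ "\<lambda>x. x 0 1"] mpoly_var z Z)
  from mpoly_plane[OF mpoly_F[OF this], of "\<lambda>_ _. 0" "\<lambda>_ l. if l = 0 then 1 else 0" "\<lambda>_ l. if l = 1 then 1 else 0"]
  obtain P where P: "\<forall>s t. F (\<lambda>v. (R v + t * ?z v) + s * ?Z v) = poly (poly P [:t:]) s" by auto
  have "degree_at_most (\<lambda>s. poly (poly P [:s:]) s) (q * k + q)"
  proof (rule degree_at_most_diagonal)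
    fix t
    have "(\<lambda>v. R v + t * ?z v) \<in> form_space scale q"
      by (intro forms_add forms_cmult z Suc.prems)
    then have "degree_at_most (\<lambda>s. F (\<lambda>v. (R v + t * ?z v) + s * ?Z v)) (q * k)"
      by (intro Suc.IH Suc.prems) auto
    then show "degree_at_most (poly (poly P [:t:])) (q * k)"
      by (simp only: P)
  next
    fix s
    interpret chow_fibre scale Basis F n \<delta> q b lam "w k" "\<lambda>v. R v + s * ?Z v"
      using Suc.prems Z by unfold_locales (auto intro!: forms_add forms_cmult)
    have "F (\<lambda>v. (R v + s * ?Z v) + t * ?z v) = poly (poly P [:t:]) s" for t
      using P[rule_format, of t s] by (simp add: add.assoc add.commute add.left_commute)
    then show "degree_at_most (\<lambda>t. poly (poly P [:t:]) s) q"
      using fibre_degree by simp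
  qed
  moreover have "F (\<lambda>v. R v + s * (\<Sum>i<Suc k. \<Prod>j<q. w i j v)) = poly (poly P [:s:]) s" for s
    using P[rule_format, of s s] by (simp add: distrib_left add.assoc add.commute add.left_commute)
  ultimately show ?case by (simp add: add.commute)
qed

text \<open>With zero remainder, the degree bound \<open>q * r\<close> meets homogeneity of degree
  \<open>q * r + 1\<close>.\<close>

theorem vanishes_on_sums:
  assumes "\<And>i j. i < r \<Longrightarrow> j < q \<Longrightarrow> w i j \<in> covec" and "\<delta> = q * r + 1"
  shows "F (\<lambda>v. \<Sum>i<r. \<Prod>j<q. w i j v) = 0"
proof (rule degree_at_most_monom_eq_0)
  let ?Z = "\<lambda>v. \<Sum>i<r. \<Prod>j<q. w i j v"
  have Z: "?Z \<in> form_space scale q"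
    by (intro sum_prod_in_forms assms(1))
  show "degree_at_most (\<lambda>\<tau>. F (\<lambda>v. 0 + \<tau> * ?Z v)) (q * r)"
    by (intro sum_degree assms(1) forms_zero) auto
  show "F (\<lambda>v. 0 + \<tau> * ?Z v) = \<tau> ^ \<delta> * F ?Z" for \<tau>
    using F_homogeneous[OF Z] by simp
  show "q * r < \<delta>" using assms(2) by simp
qed

end

section \<open>The ideal of the secant variety\<close>

context complex_space
begin

text \<open>Vanishing is required on sums of products only, a condition that is easily seen to be
  \<open>GL\<close>-stable; spans and the closure are treated afterwards.\<close>

definition sum_ideal :: "nat \<Rightarrow> nat \<Rightarrow> nat \<Rightarrow> (('v \<Rightarrow> complex) \<Rightarrow> complex) set" where
  "sum_ideal \<delta> q r = {F \<in> sym_sym scale \<delta> q.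
     \<forall>w. (\<forall>i<r. \<forall>j<q. w i j \<in> covec) \<longrightarrow> F (\<lambda>v. \<Sum>i<r. \<Prod>j<q. w i j v) = 0}"

lemma sum_idealD:
  assumes "F \<in> sum_ideal \<delta> q r" "\<And>i j. i < r \<Longrightarrow> j < q \<Longrightarrow> w i j \<in> covec"
  shows "F (\<lambda>v. \<Sum>i<r. \<Prod>j<q. w i j v) = 0"
  using assms by (simp add: sum_ideal_def)

lemma subspace_sum_ideal: "fs.subspace (sum_ideal \<delta> q r)"
proof -
  have "fs.subspace (sym_sym scale \<delta> q)"
    unfolding sym_sym_def by (rule subspace_sym_dual)
  note this[THEN fs.subspace_0] this[THEN fs.subspace_add] this[THEN fs.subspace_scale]
  then show ?thesis
    by (intro fs.subspaceI) (auto simp: sum_ideal_def pw_scale_def)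
qed

lemma span_products:
  fixes r :: nat
  assumes "\<forall>i<r. p i = fs.span {z i}" "y \<in> fs.span (\<Union>i<r. p i)"
  shows "\<exists>c. y = (\<lambda>v. \<Sum>i<r. c i * z i v)"
  using assms(2)
proof (induction rule: fs.span_induct_alt)
  case base
  show ?case by (rule exI[of _ "\<lambda>_. 0"]) (simp add: zero_fun_def)
next
  case (step a x y)
  then obtain i where i: "i < r" "x \<in> fs.span {z i}"
    using assms(1) by auto
  then obtain k where k: "x = fscale k (z i)"
    unfolding fs.span_singleton by blast
  obtain c where c: "y = (\<lambda>v. \<Sum>i<r. c i * z i v)"
    using step.IH by blast
  have "fscale a x + y = (\<lambda>v. \<Sum>i'<r. (c i' + (if i' = i then a * k else 0)) * z i' v)"
  proof
    fix v
    have "(\<Sum>i'<r. (c i' + (if i' = i then a * k else 0)) * z i' v) =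
        (\<Sum>i'<r. c i' * z i' v + (if i' = i then a * k * z i v else 0))"
      by (intro sum.cong) (auto simp: distrib_right)
    also have "\<dots> = (\<Sum>i'<r. c i' * z i' v) + a * k * z i v"
      using i(1) by (simp add: sum.distrib)
    finally show "(fscale a x + y) v = (\<Sum>i'<r. (c i' + (if i' = i then a * k else 0)) * z i' v)"
      by (simp add: pw_scale_def k c)
  qed
  then show ?case by (rule exI[of _ "\<lambda>i'. c i' + (if i' = i then a * k else 0)"])
qed

text \<open>Coefficients can be absorbed into a factor, so the span of \<open>r\<close> points of
  the Chow variety consists of sums of \<open>r\<close> products. Vanishing passes to the closure by
  definition.\<close>

lemma sum_ideal_subset:
  assumes "q > 0"
  shows "sum_ideal \<delta> q r \<subseteq> chow_secant_ideal scale \<delta> r q"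
proof
  fix F assume F: "F \<in> sum_ideal \<delta> q r"
  have zero: "F y = 0" if p: "\<forall>i<r. p i \<in> chow_dual scale q" and y: "y \<in> fs.span (\<Union>i<r. p i)" for p y
  proof -
    have "\<forall>i\<in>{..<r}. \<exists>w. (\<forall>j<q. w j \<in> covec) \<and> p i = fs.span {\<lambda>v. \<Prod>j<q. w j v}"
      using p unfolding chow_dual_def proj_points_def by blast
    then obtain w where w: "\<forall>i\<in>{..<r}. (\<forall>j<q. w i j \<in> covec) \<and> p i = fs.span {\<lambda>v. \<Prod>j<q. w i j v}"
      by (rule bchoice[THEN exE])
    then obtain c where c: "y = (\<lambda>v. \<Sum>i<r. c i * (\<Prod>j<q. w i j v))"
      using span_products[of r p "\<lambda>i v. \<Prod>j<q. w i j v" y] y by auto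
    \<comment> \<open>The coefficient goes into factor 0, which exists because
      \<open>q > 0\<close>.\<close>
    let ?w = "\<lambda>i j v. (if j = 0 then c i else 1) * w i j v"
    have "(\<Prod>j<q. ?w i j v) = c i * (\<Prod>j<q. w i j v)" for i v
      using assms by (simp only: prod.distrib) simp
    then have y: "y = (\<lambda>v. \<Sum>i<r. \<Prod>j<q. ?w i j v)"
      by (simp add: c)
    have w: "?w i j \<in> covec" if "i < r" "j < q" for i j
      using that w by (intro covec_cmult) auto
    show ?thesis
      unfolding y by (rule sum_idealD[OF F w])
  qed
  let ?X = "\<Union>p\<in>{p. \<forall>i<r. p i \<in> chow_dual scale q}. proj_points fscale (fs.span (\<Union>i<r. p i))"
  have "vanishes_on F ?X"
    unfolding vanishes_on_def
  proof (intro ballI)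
    fix l y assume "l \<in> ?X" "y \<in> l"
    then obtain p z where p: "\<forall>i<r. p i \<in> chow_dual scale q" and z: "z \<in> fs.span (\<Union>i<r. p i)" "y \<in> fs.span {z}"
      unfolding proj_points_def by blast
    have "y \<in> fs.span (\<Union>i<r. p i)"
      using z fs.span_minimal[of "{z}" "fs.span (\<Union>i<r. p i)"] fs.subspace_span by blast
    then show "F y = 0" by (rule zero[OF p])
  qed
  moreover have "F \<in> sym_dual fscale (form_space scale q) \<delta>"
    using F by (simp add: sum_ideal_def sym_sym_def)
  ultimately show "F \<in> chow_secant_ideal scale \<delta> r q"
    unfolding chow_secant_ideal_def proj_ideal_def secant_variety_def zariski_closure_def
    by (auto simp: vanishes_on_def)
qed

text \<open>A linear change of variables preserves sums of products of forms, so the intersection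
  with \<open>M\<close> is a submodule; it contains \<open>F \<noteq> 0\<close> and is therefore all
  of \<open>M\<close>.\<close>

lemma irreducible_subset_sum_ideal:
  assumes M: "irreducible_gl_module scale fscale gl_action M" "M \<subseteq> sym_sym scale \<delta> q"
    and F: "F \<in> M" "F \<in> sum_ideal \<delta> q r" "F \<noteq> 0"
  shows "M \<subseteq> sum_ideal \<delta> q r"
proof -
  let ?N = "M \<inter> sum_ideal \<delta> q r"
  have gl: "gl_module scale fscale gl_action M"
    using M(1) by (simp add: irreducible_gl_module_def)
  have "gl_action g G \<in> ?N" if g: "g \<in> GL scale" and G: "G \<in> ?N" for g G
  proof -
    have "gl_action g G \<in> M"
      using gl g G unfolding gl_module_def by blast
    moreover have "gl_action g G (\<lambda>v. \<Sum>i<r. \<Prod>j<q. w i j v) = 0" if "\<forall>i<r. \<forall>j<q. w i j \<in> covec" for w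
    proof -
      have "lin g" using g by (simp add: GL_def)
      have "G (\<lambda>v. \<Sum>i<r. \<Prod>j<q. w i j (g v)) = 0"
        by (rule sum_idealD[where w = "\<lambda>i j v. w i j (g v)"])
          (use G in blast, rule covec_comp[OF _ \<open>lin g\<close>], use that in blast)
      then show ?thesis by (simp add: gl_action_def comp_def)
    qed
    ultimately show ?thesis
      using M(2) by (auto simp: sum_ideal_def)
  qed
  moreover have "fs.subspace ?N"
    using gl subspace_sum_ideal unfolding gl_module_def by (intro fs.subspace_inter) auto
  ultimately have "gl_module scale fscale gl_action ?N"
    using gl unfolding gl_module_def by blast
  then have "?N = {0} \<or> ?N = M"
    using M(1) unfolding irreducible_gl_module_def by blast
  then show ?thesis
    using F by blast
qed

text \<open>The two weight bounds are read off from the first index \<open>i\<close> at which the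
  partitions differ.\<close>

lemma schur_module_subset_sum_ideal:
  assumes q: "even q" "2 \<le> q" "q \<le> dim (UNIV :: 'v set)" and r: "1 \<le> r"
    and lam: "even_partition lam" "partition_less lam (replicate (q - 1) (q + 2) @ [2])"
    and M: "is_schur_module scale fscale gl_action lam M" "M \<subseteq> sym_sym scale (q * r + 1) q"
  shows "M \<subseteq> sum_ideal (q * r + 1) q r"
proof -
  let ?\<delta> = "q * r + 1"
  obtain n b F where hw: "ordered_basis scale n b" "F \<in> M" "F \<noteq> 0"
    "\<forall>g\<in>GL scale. (\<forall>j<n. g (b j) - b j \<in> span (b ` {..<j})) \<longrightarrow> gl_action g F = F"
    "\<forall>g\<in>GL scale. \<forall>t. (\<forall>i<n. g (b i) = scale (t i) (b i)) \<longrightarrow>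
       gl_action g F = fscale (\<Prod>i<n. t i ^ nth_default 0 lam i) F"
    using M(1) unfolding is_schur_module_def has_highest_weight_def by blast
  interpret highest_weight_vector scale Basis F n ?\<delta> q b lam
    by unfold_locales (use hw M(2) in blast)+
  let ?L = "nth_default 0 lam"
  have anti: "?L j \<le> ?L i" if "i \<le> j" for i j
    using lam(1) that sorted_wrt_nth_less[of "(\<ge>)" lam i j]
    by (cases "i = j") (auto simp: even_partition_def is_partition_def nth_default_def)
  have even: "even (?L i)" for i
    using lam(1) by (auto simp: even_partition_def nth_default_def)
  have T: "nth_default 0 (replicate (q - 1) (q + 2) @ [2]) i =
      (if i < q - 1 then q + 2 else if i = q - 1 then 2 else 0)" for i
    by (auto simp: nth_default_def nth_append)
  obtain i where i: "?L i < (if i < q - 1 then q + 2 else if i = q - 1 then 2 else 0)"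
    "\<forall>j<i. ?L j = (if j < q - 1 then q + 2 else if j = q - 1 then 2 else 0)"
    using lam(2) unfolding partition_less_def T by blast
  have "i \<le> q - 1" using i(1) by (auto split: if_splits)
  have "?L 0 \<le> q + 2"
    using i q by (cases "i = 0") (auto split: if_splits)
  then have "weight_sum 1 \<le> q + 2"
    by (simp add: weight_sum_def)
  moreover have "weight_sum (q - 1) < (q - 1) * (q + 2)"
  proof (cases "i < q - 1")
    case True
    \<comment> \<open>The first \<open>q - 1\<close> parts are at most \<open>q + 2\<close>,
      strictly so at \<open>i\<close>.\<close>
    have "weight_sum (q - 1) < (\<Sum>j<q - 1. q + 2)"
      unfolding weight_sum_def
    proof (rule sum_strict_mono_ex1)
      show "\<forall>j\<in>{..<q - 1}. ?L j \<le> q + 2"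
        using anti[of 0] \<open>?L 0 \<le> q + 2\<close> order_trans by blast
      show "\<exists>j\<in>{..<q - 1}. ?L j < q + 2"
        using i(1) True by (intro bexI[of _ i]) auto
    qed simp
    then show ?thesis by simp
  next
    case False
    \<comment> \<open>Evenness turns the part below 2 into 0, so \<open>lam\<close> consists of
      \<open>q - 1\<close> parts \<open>q + 2\<close>. Its size is then smaller than
      \<open>q * ?\<delta>\<close>, against \<open>weight_sum_total\<close>.\<close>
    then have "i = q - 1" using \<open>i \<le> q - 1\<close> by simp
    then have "?L (q - 1) < 2" using i(1) by simp
    then have "?L (q - 1) = 0" using even[of "q - 1"] by (auto elim: evenE)
    then have "?L j = 0" if "q - 1 \<le> j" for j
      using anti[OF that] by simp
    then have "weight_sum n = weight_sum (q - 1)"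
      unfolding weight_sum_def using q(3) n_eq_dim by (intro sum.mono_neutral_right) auto
    also have "\<dots> = (q - 1) * (q + 2)"
      unfolding weight_sum_def using i(2) \<open>i = q - 1\<close> by simp
    finally have "q * ?\<delta> = (q - 1) * (q + 2)"
      using weight_sum_total hw(3) by (simp add: zero_fun_def)
    moreover have "(q - 1) * (q + 2) < q * (q + 1)"
      using q(2) by (cases q) (auto simp: algebra_simps)
    moreover have "q * (q + 1) \<le> q * ?\<delta>"
      using r by simp
    ultimately show ?thesis by simp
  qed
  ultimately interpret chow_weight scale Basis F n ?\<delta> q b lam
    using q n_eq_dim by unfold_locales auto
  have "F \<in> sum_ideal ?\<delta> q r"
    unfolding sum_ideal_def using vanishes_on_sums[where r = r] hw(2) M(2) by auto
  then show ?thesis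
    using M hw by (intro irreducible_subset_sum_ideal[of M _ _ F]) (auto simp: is_schur_module_def)
qed

end

theorem theorem1p5:
  fixes scale :: "complex \<Rightarrow> 'v::ab_group_add \<Rightarrow> 'v" and Basis :: "'v set" and m r :: nat
  assumes "finite_dimensional_vector_space scale Basis"
    and "m \<ge> 2" and "r \<ge> 1"
    and "vector_space.dim scale (UNIV :: 'v set) \<ge> 2 * m * r"
  shows "isotypic_component scale fscale gl_action
             (replicate m (2 * m + 2) @ replicate (2 * m * r - m) (2 * m))
             (sym_sym scale (2 * m * r + 1) (2 * m))
           \<subseteq> chow_secant_ideal scale (2 * m * r + 1) r (2 * m) \<and>
         (\<forall>lam M. even_partition lam \<and>
                partition_less lam (replicate (2 * m - 1) (2 * m + 2) @ [2]) \<and>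
                M \<subseteq> sym_sym scale (2 * m * r + 1) (2 * m) \<and>
                is_schur_module scale fscale gl_action lam M
            \<longrightarrow> M \<subseteq> chow_secant_ideal scale (2 * m * r + 1) r (2 * m))"
proof -
  interpret complex_space scale Basis
    using assms(1) by (simp add: complex_space_def)
  let ?J = "sum_ideal (2 * m * r + 1) (2 * m) r"
  let ?I = "chow_secant_ideal scale (2 * m * r + 1) r (2 * m)"
  let ?lam = "replicate m (2 * m + 2) @ replicate (2 * m * r - m) (2 * m)"
  have "2 * m * 1 \<le> 2 * m * r"
    using assms(3) by (rule mult_le_mono2)
  then have dim: "2 * m \<le> dim (UNIV :: 'v set)" and pos: "2 * m * r - m > 0"
    using assms(2,4) by linarith+
  have J_I: "?J \<subseteq> ?I"
    using assms(2) by (intro sum_ideal_subset) simp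
  have M_J: "M \<subseteq> ?J" if "even_partition lam" "partition_less lam (replicate (2 * m - 1) (2 * m + 2) @ [2])"
    "M \<subseteq> sym_sym scale (2 * m * r + 1) (2 * m)" "is_schur_module scale fscale gl_action lam M" for lam M
    using that assms(2,3) dim by (intro schur_module_subset_sum_ideal) auto
  have lt: "j < 2 * m * r" if "j < m" for j
    using that pos by linarith
  \<comment> \<open>The lists first differ at index \<open>m\<close>, where
    \<open>2 * m < 2 * m + 2\<close>; by \<open>m \<ge> 2\<close> this index precedes that of the
    final entry 2.\<close>
  have "partition_less ?lam (replicate (2 * m - 1) (2 * m + 2) @ [2])"
    unfolding partition_less_def using assms(2) pos
    by (intro exI[of _ m]) (auto simp: nth_default_def nth_append dest: lt)
  moreover have "even_partition ?lam" if "is_schur_module scale fscale gl_action ?lam M" for M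
    using that by (auto simp: even_partition_def is_schur_module_def)
  ultimately have "\<Union>{M. M \<subseteq> sym_sym scale (2 * m * r + 1) (2 * m) \<and> is_schur_module scale fscale gl_action ?lam M} \<subseteq> ?J"
    using M_J by blast
  then have "isotypic_component scale fscale gl_action ?lam (sym_sym scale (2 * m * r + 1) (2 * m)) \<subseteq> ?J"
    unfolding isotypic_component_def by (intro fs.span_minimal subspace_sum_ideal)
  then show ?thesis
    using J_I M_J by blast
qed

end
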